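(* Let $N\geq 3$ and let $u$ be a radially symmetric solution of $|x|^{-2}\partial_t u=\Delta u$ in $\mathbb{R}^N\times(0,\infty)$ with initial data $u_0\in L^1_2(\mathbb{R}^N)$, $u_0\geq 0$, satisfying moreover $$M_{u_0}:=\int_{\mathbb{R}^N}|x|^{-N}u_0(x)\,dx<\infty,\qquad u_0(0)=0.$$ Then $$\lim_{t\to\infty}t^{1/2}\left\|u(\cdot,t)-\frac{M_{u_0}}{\omega_1}F(\cdot,t)\right\|_{\infty}=0,$$ where $\omega_1$ is the area of the unit sphere in $\mathbb{R}^N$ and $$F(x,t):=\frac{1}{\sqrt{4\pi t}}\,G\!\left(\frac{\log|x|+(N-2)t}{2\sqrt{t}}\right)\ \text{ for } x\neq 0,\qquad G(\xi)=e^{-\xi^2},\qquad F(0,t):=0.$$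
   Context: $L^1_2(\mathbb{R}^N)$ is the space of measurable $h:\mathbb{R}^N\to\mathbb{R}$ with $\int_{\mathbb{R}^N}|x|^{-2}|h(x)|\,dx<\infty$. A weak solution of $|x|^{-2}u_t=\Delta u$ in $\mathbb{R}^N\times(0,\infty)$ with initial data $u_0$ is a function $u\geq 0$ such that $u\in C([0,\infty);L^1_2(\mathbb{R}^N))\cap L^\infty(\mathbb{R}^N\times(\tau,\infty))$ for every $\tau>0$, $u(0)=u_0$, and $\iint u(\Delta\varphi+|x|^{-2}\varphi_t)\,dx\,dt=0$ for all $\varphi\in C_0^\infty(\mathbb{R}^N\times(0,\infty))$. A strong solution is a weak solution with $|x|^{-2}u_t,\ \Delta u\in L^1_{\rm loc}(Q_* )$ and $|x|^{-2}u_t=\Delta u$ a.e. in $Q_*$, where $Q_*=(\mathbb{R}^N\times(0,\infty))\setminus\{(0,t):t>0\}$. "Solution" means strong solution. Radially symmetric means $u(x,t)$ depends only on $|x|$ and $t$. $\|\cdot\|_\infty$ is the norm of $L^\infty(\mathbb{R}^N)$ in the variable $x$. *)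

theory Defs
  imports "HOL-Analysis.Analysis" "HOL-Probability.Essential_Supremum"
begin

text \<open>
  Throughout, \<open>'a\<close> is the space variable ($\mathbb{R}^N$ with $N = $ \<open>DIM('a)\<close>) and points of
  space-time are pairs \<open>(x, t)\<close>.  "Measurable" means Lebesgue measurable.  Since
  \<open>c / 0 = 0\<close>, the singular weights get the value 0 at the origin, a null set.
\<close>

section \<open>Test functions\<close>

definition dir_deriv :: "'b::euclidean_space \<Rightarrow> ('b \<Rightarrow> real) \<Rightarrow> 'b \<Rightarrow> real" where
  "dir_deriv v f z = frechet_derivative f (at z) v"

primrec Ck :: "nat \<Rightarrow> ('b::euclidean_space \<Rightarrow> real) \<Rightarrow> bool" where
  "Ck 0 f \<longleftrightarrow> continuous_on UNIV f"
| "Ck (Suc k) f \<longleftrightarrow> (\<forall>z. f differentiable (at z)) \<and> (\<forall>v. Ck k (dir_deriv v f))"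

definition smooth :: "('b::euclidean_space \<Rightarrow> real) \<Rightarrow> bool" where
  "smooth f \<longleftrightarrow> (\<forall>k. Ck k f)"

definition test_function :: "'b::euclidean_space set \<Rightarrow> ('b \<Rightarrow> real) \<Rightarrow> bool" where
  "test_function \<Omega> \<phi> \<longleftrightarrow>
     smooth \<phi> \<and> compact (closure {z. \<phi> z \<noteq> 0}) \<and> closure {z. \<phi> z \<noteq> 0} \<subseteq> \<Omega>"

definition time_deriv :: "('a::euclidean_space \<times> real \<Rightarrow> real) \<Rightarrow> 'a \<times> real \<Rightarrow> real" where
  "time_deriv \<phi> = dir_deriv (0, 1) \<phi>"

definition laplacian :: "('a::euclidean_space \<times> real \<Rightarrow> real) \<Rightarrow> 'a \<times> real \<Rightarrow> real" where
  "laplacian \<phi> z = (\<Sum>b\<in>Basis. dir_deriv (b, 0) (dir_deriv (b, 0) \<phi>) z)"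


section \<open>Function spaces\<close>

definition Linfty_norm :: "'b measure \<Rightarrow> ('b \<Rightarrow> real) \<Rightarrow> ereal" where
  "Linfty_norm M f = esssup M (\<lambda>z. ereal \<bar>f z\<bar>)"

definition in_Linfty :: "'b measure \<Rightarrow> ('b \<Rightarrow> real) \<Rightarrow> bool" where
  "in_Linfty M f \<longleftrightarrow> f \<in> borel_measurable M \<and> Linfty_norm M f < \<infinity>"

definition in_L12 :: "('a::euclidean_space \<Rightarrow> real) \<Rightarrow> bool" where
  "in_L12 h \<longleftrightarrow> h \<in> borel_measurable lebesgue \<and> integrable lebesgue (\<lambda>x. \<bar>h x\<bar> / (norm x)\<^sup>2)"

definition L12_norm :: "('a::euclidean_space \<Rightarrow> real) \<Rightarrow> real" where
  "L12_norm h = (LINT x|lebesgue. \<bar>h x\<bar> / (norm x)\<^sup>2)"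

definition continuous_in_L12 :: "('a::euclidean_space \<Rightarrow> real \<Rightarrow> real) \<Rightarrow> bool" where
  "continuous_in_L12 u \<longleftrightarrow>
     (\<forall>t\<ge>0. in_L12 (\<lambda>x. u x t)) \<and>
     (\<forall>s\<ge>0. ((\<lambda>t. L12_norm (\<lambda>x. u x t - u x s)) \<longlongrightarrow> 0) (at s within {0..}))"

definition locally_integrable :: "'b::euclidean_space set \<Rightarrow> ('b \<Rightarrow> real) \<Rightarrow> bool" where
  "locally_integrable \<Omega> f \<longleftrightarrow> (\<forall>K. compact K \<and> K \<subseteq> \<Omega> \<longrightarrow> set_integrable lebesgue K f)"


section \<open>Weak and strong solutions\<close>

definition Q :: "('a::euclidean_space \<times> real) set" where
  "Q = UNIV \<times> {0<..}"

definition Q_star :: "('a::euclidean_space \<times> real) set" where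
  "Q_star = Q - {(0, t) | t. t > 0}"

text \<open>
  Solutions are elements of Lebesgue spaces, represented by functions; all pointwise
  requirements are accordingly imposed almost everywhere in \<open>x\<close>, for every \<open>t\<close>.
\<close>

definition weak_solution ::
    "('a::euclidean_space \<Rightarrow> real) \<Rightarrow> ('a \<Rightarrow> real \<Rightarrow> real) \<Rightarrow> bool" where
  "weak_solution u0 u \<longleftrightarrow>
     (\<forall>t\<ge>0. AE x in lebesgue. u x t \<ge> 0) \<and>
     continuous_in_L12 u \<and>
     (\<forall>\<tau>>0. in_Linfty (lebesgue_on (UNIV \<times> {\<tau><..})) (\<lambda>(x, t). u x t)) \<and>
     (AE x in lebesgue. u x 0 = u0 x) \<and>
     (\<forall>\<phi>. test_function Q \<phi> \<longrightarrow>
        (LINT (x, t):Q|lebesgue.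
           u x t * (laplacian \<phi> (x, t) + time_deriv \<phi> (x, t) / (norm x)\<^sup>2)) = 0)"

definition distributional_time_deriv ::
    "('a::euclidean_space \<times> real) set \<Rightarrow> ('a \<times> real \<Rightarrow> real) \<Rightarrow> ('a \<times> real \<Rightarrow> real) \<Rightarrow> bool" where
  "distributional_time_deriv \<Omega> f g \<longleftrightarrow>
     locally_integrable \<Omega> f \<and> locally_integrable \<Omega> g \<and>
     (\<forall>\<phi>. test_function \<Omega> \<phi> \<longrightarrow>
        (LINT z:\<Omega>|lebesgue. f z * time_deriv \<phi> z) = - (LINT z:\<Omega>|lebesgue. g z * \<phi> z))"

definition distributional_laplacian ::
    "('a::euclidean_space \<times> real) set \<Rightarrow> ('a \<times> real \<Rightarrow> real) \<Rightarrow> ('a \<times> real \<Rightarrow> real) \<Rightarrow> bool" where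
  "distributional_laplacian \<Omega> f g \<longleftrightarrow>
     locally_integrable \<Omega> f \<and> locally_integrable \<Omega> g \<and>
     (\<forall>\<phi>. test_function \<Omega> \<phi> \<longrightarrow>
        (LINT z:\<Omega>|lebesgue. f z * laplacian \<phi> z) = (LINT z:\<Omega>|lebesgue. g z * \<phi> z))"

definition strong_solution ::
    "('a::euclidean_space \<Rightarrow> real) \<Rightarrow> ('a \<Rightarrow> real \<Rightarrow> real) \<Rightarrow> bool" where
  "strong_solution u0 u \<longleftrightarrow>
     weak_solution u0 u \<and>
     (\<exists>u_t \<Delta>u.
        distributional_time_deriv Q_star (\<lambda>(x, t). u x t) u_t \<and>
        distributional_laplacian Q_star (\<lambda>(x, t). u x t) \<Delta>u \<and>
        locally_integrable Q_star (\<lambda>(x, t). u_t (x, t) / (norm x)\<^sup>2) \<and>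
        (AE (x, t) in lebesgue_on Q_star. u_t (x, t) / (norm x)\<^sup>2 = \<Delta>u (x, t)))"

definition radially_symmetric :: "('a::euclidean_space \<Rightarrow> real \<Rightarrow> real) \<Rightarrow> bool" where
  "radially_symmetric u \<longleftrightarrow> (\<exists>g. \<forall>t>0. AE x in lebesgue. u x t = g (norm x) t)"


section \<open>The asymptotic profile\<close>

text \<open>
  Surface measure on the unit sphere, as in polar coordinates: $N$ times the volume of the
  cone over \<open>E\<close>.
\<close>

definition sphere_measure :: "'a::euclidean_space set \<Rightarrow> real" where
  "sphere_measure E =
     real DIM('a) * measure lebesgue {r *\<^sub>R \<theta> | r \<theta>. 0 < r \<and> r \<le> 1 \<and> \<theta> \<in> E}"

definition unit_sphere_area :: "'a::euclidean_space itself \<Rightarrow> real" where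
  "unit_sphere_area _ = sphere_measure (sphere (0::'a) 1)"

definition G :: "real \<Rightarrow> real" where
  "G \<xi> = exp (- \<xi>\<^sup>2)"

definition F :: "'a::euclidean_space \<Rightarrow> real \<Rightarrow> real" where
  "F x t =
     (if x = 0 then 0
      else 1 / sqrt (4 * pi * t) * G ((ln (norm x) + (real DIM('a) - 2) * t) / (2 * sqrt t)))"

lemma unit_sphere_area_eq:
  "unit_sphere_area TYPE('a::euclidean_space) =
     2 * pi powr (real DIM('a) / 2) / Gamma (real DIM('a) / 2)"
proof -
  have "{r *\<^sub>R \<theta> | r \<theta>. 0 < r \<and> r \<le> 1 \<and> \<theta> \<in> sphere (0::'a) 1} = cball 0 1 - {0}" (is "?L = ?R")
  proof
    show "?L \<subseteq> ?R" by (auto simp: abs_of_pos)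
    show "?R \<subseteq> ?L"
    proof
      fix x :: 'a assume x: "x \<in> ?R"
      then have "x = norm x *\<^sub>R (x /\<^sub>R norm x) \<and> 0 < norm x \<and> norm x \<le> 1 \<and> x /\<^sub>R norm x \<in> sphere 0 1"
        by auto
      then show "x \<in> ?L" by blast
    qed
  qed
  moreover have "measure lebesgue (cball (0::'a) 1 - {0}) = measure lebesgue (cball (0::'a) 1)"
    by (rule measure_negligible_symdiff)
       (auto intro: negligible_subset[OF negligible_sing, of _ 0])
  moreover have "Gamma (real DIM('a) / 2 + 1) = real DIM('a) / 2 * Gamma (real DIM('a) / 2)"
  proof (rule Gamma_plus1)
    have "real DIM('a) / 2 > 0" by simp
    then show "real DIM('a) / 2 \<notin> \<int>\<^sub>\<le>\<^sub>0" by (meson nonpos_Ints_nonpos not_le)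
  qed
  ultimately show ?thesis
    by (simp add: unit_sphere_area_def sphere_measure_def content_cball unit_ball_vol_def)
qed

end

theory Submission
  imports Defs "HOL-Probability.Probability"
begin

text \<open>
  In the variable \<open>s = ln |x|\<close> the operator \<open>|x|\<^sup>2 \<Delta>\<close> acts on radial functions as
  \<open>\<partial>\<^sup>2/\<partial>s\<^sup>2 + (N - 2) \<partial>/\<partial>s\<close>.  The equation is therefore a heat equation with constant drift on the
  line, whose integrable solutions are Gaussian convolutions of their initial data.  The measure
  \<open>|x|\<^sup>-\<^sup>2 dx\<close> becomes a multiple of \<open>exp ((N - 2) s) ds\<close>, so that \<open>u(x, t) |x|\<^sup>-\<^sup>2 dx\<close> becomes a finite
  measure on the line, depending continuously on \<open>t \<ge> 0\<close>.

  The convolution formula is derived through the Fourier transform of this measure.  Test functions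
  \<open>A (ln |x|) \<theta>(t)\<close> yield a weak evolution equation for its integrals against \<open>A\<close>
  (\<open>weak_solution_radial_test\<close>).  Letting \<open>\<theta>\<close> tend to the indicator of a time interval and \<open>A\<close> to a
  cosine, one finds that the Fourier transform \<open>c\<close> satisfies \<open>c' = (- \<xi>\<^sup>2 + i (N - 2) \<xi>) c\<close>
  (\<open>weak_solution_fourier\<close>).  Both limits are dominated convergence, because this measure is finite, and
  continuity up to time 0 identifies the initial value.  Hence \<open>c\<close> at time \<open>t\<close> is the transform of the initial
  measure times that of the normal law with mean \<open>(N - 2) t\<close> and variance \<open>2 t\<close>, and uniqueness of
  characteristic functions identifies the densities (\<open>densities_eq_of_cos_integrals\<close>).  In terms of \<open>u\<close> this
  reads (\<open>radial_weak_solution_formula\<close>)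

  \<open>u(x, t) = \<omega>\<^sub>1\<^sup>-\<^sup>1 \<integral> H\<^sub>t (ln |x| - ln |z|) |z|\<^sup>-\<^sup>N u\<^sub>0(z) dz\<close>, where \<open>H\<^sub>t (ln |x|) = F(x, t)\<close>.

  Since \<open>M\<close> is the integral of \<open>|z|\<^sup>-\<^sup>N u\<^sub>0(z)\<close>, the function \<open>M F / \<omega>\<^sub>1\<close> is the same integral with \<open>ln |z|\<close>
  replaced by 0.  The estimate \<open>sqrt t |H\<^sub>t (S - Z) - H\<^sub>t S| \<le> min 1 (|Z| / (2 sqrt t))\<close>, uniform in \<open>S\<close>, follows from
  \<open>gauss_lipschitz\<close>, and dominated convergence in \<open>z\<close> concludes.
\<close>


section \<open>Differentiability calculus for the classes of smooth functions\<close>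

lemma dir_derivI:
  assumes "(f has_derivative f') (at z)"
  shows "dir_deriv v f z = f' v"
  unfolding dir_deriv_def using frechet_derivative_at[OF assms] by simp

lemma Ck_SucI:
  assumes "\<And>z. (f has_derivative f' z) (at z)" "\<And>v. Ck k (\<lambda>z. f' z v)"
  shows "Ck (Suc k) f"
proof -
  have "dir_deriv v f = (\<lambda>z. f' z v)" for v
    by (rule ext) (rule dir_derivI[OF assms(1)])
  then show ?thesis
    using assms by (auto simp: differentiable_def)
qed

lemma Ck_Suc_has_derivative:
  assumes "Ck (Suc k) f"
  shows "(f has_derivative (\<lambda>v. dir_deriv v f z)) (at z)"
  using assms unfolding dir_deriv_def
  by (simp add: frechet_derivative_works[symmetric])

text \<open>
  A differentiable function is continuous; this is the base case, and it makes the classes \<open>Ck k\<close>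
  decreasing in \<open>k\<close>.  The product rule below relies on it, because it multiplies a derivative by
  an undifferentiated factor.
\<close>

lemma Ck_SucD: "Ck (Suc k) f \<Longrightarrow> Ck k f"
proof (induction k arbitrary: f)
  case 0
  then show ?case
    by (auto intro!: continuous_at_imp_continuous_on differentiable_imp_continuous_within)
next
  case (Suc k)
  then show ?case by auto
qed

lemma Ck_const: "Ck k (\<lambda>z. c)"
proof (induction k arbitrary: c)
  case (Suc k)
  show ?case by (rule Ck_SucI[where f' = "\<lambda>z v. 0"]) (auto intro: Suc)
qed auto

lemma Ck_add: "Ck k f \<Longrightarrow> Ck k g \<Longrightarrow> Ck k (\<lambda>z. f z + g z)"
proof (induction k arbitrary: f g)
  case (Suc k)
  show ?case
    by (rule Ck_SucI[OF has_derivative_add[OF Ck_Suc_has_derivative Ck_Suc_has_derivative]])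
       (use Suc in auto)
qed (auto intro: continuous_intros)

lemma Ck_mult: "Ck k f \<Longrightarrow> Ck k g \<Longrightarrow> Ck k (\<lambda>z. f z * g z)"
proof (induction k arbitrary: f g)
  case (Suc k)
  show ?case
    by (rule Ck_SucI[OF has_derivative_mult[OF Ck_Suc_has_derivative Ck_Suc_has_derivative]])
       (use Suc Ck_SucD[OF Suc.prems(1)] Ck_SucD[OF Suc.prems(2)] in \<open>auto intro!: Ck_add\<close>)
qed (auto intro: continuous_intros)

lemma Ck_diff:
  assumes "Ck k f" "Ck k g" shows "Ck k (\<lambda>z. f z - g z)"
  using Ck_add[OF assms(1) Ck_mult[OF Ck_const assms(2), of "-1"]] by simp

text \<open>
  Translations, dilations and the coordinate projections of space-time are all of this form.
\<close>

lemma Ck_affine: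
  fixes L :: "'c::euclidean_space \<Rightarrow> 'b::euclidean_space"
  assumes L: "bounded_linear L"
  shows "Ck k f \<Longrightarrow> Ck k (\<lambda>z. f (L z + c))"
proof (induction k arbitrary: f)
  case 0
  then show ?case
    using continuous_on_compose2[of UNIV f UNIV "\<lambda>z. L z + c"]
      continuous_on_add[OF linear_continuous_on[OF L, of UNIV] continuous_on_const]
    by simp
next
  case (Suc k)
  have 1: "((\<lambda>z. L z + c) has_derivative L) (at z)" for z
    by (rule has_derivative_add_const[OF bounded_linear_imp_has_derivative[OF L]])
  show ?case
    by (rule Ck_SucI[OF has_derivative_compose[OF 1 Ck_Suc_has_derivative[OF Suc.prems]]])
       (use Suc in auto)
qed

lemma Ck_linear:
  assumes L: "bounded_linear L" shows "Ck k L"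
proof (cases k)
  case (Suc m)
  show ?thesis unfolding Suc
    by (rule Ck_SucI[OF bounded_linear_imp_has_derivative[OF L]]) (rule Ck_const)
qed (use linear_continuous_on[OF L, of UNIV] in auto)

lemma Ck_inverse:
  fixes f :: "'b::euclidean_space \<Rightarrow> real"
  assumes "\<And>z. f z \<noteq> 0"
  shows "Ck k f \<Longrightarrow> Ck k (\<lambda>z. inverse (f z))"
proof (induction k)
  case 0
  then show ?case using assms by (auto intro!: continuous_intros)
next
  case (Suc k)
  have "Ck k (\<lambda>z. (-1) * (inverse (f z) * dir_deriv v f z * inverse (f z)))" for v
    using Suc.prems by (intro Ck_mult Ck_const Suc.IH Ck_SucD[OF Suc.prems]) auto
  then have 1: "Ck k (\<lambda>z. - (inverse (f z) * dir_deriv v f z * inverse (f z)))" for v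
    by simp
  show ?case
    by (rule Ck_SucI[OF Deriv.has_derivative_inverse[OF assms Ck_Suc_has_derivative[OF Suc.prems]] 1])
qed

lemma Ck_Suc_real:
  fixes f :: "real \<Rightarrow> real"
  assumes "\<And>x. (f has_real_derivative f' x) (at x)" "Ck k f'"
  shows "Ck (Suc k) f"
  by (rule Ck_SucI[OF assms(1)[unfolded has_field_derivative_def]])
     (intro Ck_mult assms Ck_const)

lemma Ck_exp: "Ck k (\<lambda>s::real. exp (c * s))"
proof (induction k)
  case (Suc k)
  have "((\<lambda>s. exp (c * s)) has_real_derivative c * exp (c * s)) (at s)" for s
    by (auto intro!: derivative_eq_intros)
  then show ?case
    by (rule Ck_Suc_real) (intro Ck_mult Suc Ck_const)
qed (auto intro!: continuous_intros)

lemma Ck_cos: "Ck k (\<lambda>s::real. cos (c * s + d))"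
proof (induction k arbitrary: d)
  case (Suc k)
  have "((\<lambda>s. cos (c * s + d)) has_real_derivative c * cos (c * s + (d + pi / 2))) (at s)" for s
    by (auto intro!: derivative_eq_intros simp: cos_add sin_add algebra_simps)
  then show ?case
    by (rule Ck_Suc_real) (intro Ck_mult Suc Ck_const)
qed (auto intro!: continuous_intros)

lemma smooth_real_has_deriv:
  fixes f :: "real \<Rightarrow> real"
  assumes "smooth f"
  shows "(f has_real_derivative deriv f x) (at x)"
proof -
  have "Ck (Suc 0) f" using assms unfolding smooth_def by blast
  then show ?thesis
    by (auto simp: DERIV_deriv_iff_real_differentiable)
qed

lemma smooth_real_deriv:
  fixes f :: "real \<Rightarrow> real"
  assumes "smooth f"
  shows "smooth (deriv f)"
  unfolding smooth_def
proof
  fix k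
  have "Ck (Suc k) f" using assms unfolding smooth_def by blast
  moreover have "dir_deriv 1 f = deriv f"
    using dir_derivI[OF smooth_real_has_deriv[OF assms, unfolded has_field_derivative_def], of 1]
    by (intro ext) simp
  ultimately show "Ck k (deriv f)" by (metis Ck.simps(2))
qed

lemma smooth_mult_exp:
  fixes A :: "real \<Rightarrow> real"
  assumes "smooth A" shows "smooth (\<lambda>s. A s * exp (c * s))"
  using assms unfolding smooth_def by (auto intro: Ck_mult Ck_exp)

lemma derivative_zero_on_open:
  fixes A :: "real \<Rightarrow> real"
  assumes "(A has_real_derivative D) (at s)" "open S" "s \<in> S" "\<And>s. s \<in> S \<Longrightarrow> A s = 0"
  shows "D = 0"
proof -
  have "((\<lambda>x. 0) has_real_derivative 0) (at s)" by simp
  then have "(A has_real_derivative 0) (at s)"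
    by (rule has_field_derivative_transform_within_open[where S = S]) (use assms in auto)
  then show ?thesis using assms(1) DERIV_unique by blast
qed

lemma deriv_zero_on_open:
  fixes A :: "real \<Rightarrow> real"
  assumes "smooth A" "open S" "\<And>s. s \<in> S \<Longrightarrow> A s = 0" "s \<in> S"
  shows "deriv A s = 0"
  using derivative_zero_on_open[OF smooth_real_has_deriv[OF assms(1)]] assms by blast

lemma smooth_continuous:
  assumes "smooth f" shows "continuous_on S f"
proof -
  have "Ck 0 f" using assms unfolding smooth_def by blast
  then show ?thesis by (auto intro: continuous_on_subset)
qed

lemma smooth_borel_measurable:
  fixes f :: "real \<Rightarrow> real"
  assumes "smooth f" shows "f \<in> borel_measurable borel"
  using smooth_continuous[OF assms] by (rule borel_measurable_continuous_onI)

lemma smooth_real_bounded: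
  fixes f :: "real \<Rightarrow> real"
  assumes "smooth f" "\<And>s. \<bar>s\<bar> > R \<Longrightarrow> f s = 0"
  obtains C where "\<And>s. \<bar>f s\<bar> \<le> C"
proof -
  have "compact (f ` {-\<bar>R\<bar>..\<bar>R\<bar>})"
    by (intro compact_continuous_image smooth_continuous assms) auto
  then obtain C where C: "\<And>s. s \<in> {-\<bar>R\<bar>..\<bar>R\<bar>} \<Longrightarrow> norm (f s) \<le> C"
    by (metis bounded_iff compact_imp_bounded imageI)
  have "\<bar>f s\<bar> \<le> \<bar>C\<bar>" for s
    using C[of s] assms(2)[of s] by (cases "s \<in> {-\<bar>R\<bar>..\<bar>R\<bar>}") auto
  then show ?thesis by (rule that)
qed


section \<open>A smooth step function\<close>

text \<open>
  The function \<open>exp (- 1 / x)\<close>, continued by 0 to the negative half-line, times a power of \<open>1 / x\<close>.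
  Carrying the power along makes the family closed under differentiation, so that smoothness at 0
  follows by induction for all members at once.
\<close>

definition flat_exp :: "nat \<Rightarrow> real \<Rightarrow> real" where
  "flat_exp m x = (if x > 0 then exp (- inverse x) * inverse x ^ m else 0)"

lemma flat_exp_tendsto: "((\<lambda>x. exp (- inverse x) * inverse x ^ m) \<longlongrightarrow> (0::real)) (at_right 0)"
  by real_asymp

text \<open>
  This limit is also the difference quotient at 0 of the member of the family with one power less.
\<close>

lemma flat_exp_isolated_tendsto: "(flat_exp m \<longlongrightarrow> 0) (at 0)"
proof (subst filterlim_at_split, intro conjI)
  show "(flat_exp m \<longlongrightarrow> 0) (at_left 0)"
    by (rule tendsto_eventually) (auto simp: flat_exp_def eventually_at_left_field intro: lt_ex)
  show "(flat_exp m \<longlongrightarrow> 0) (at_right 0)"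
    by (rule Lim_transform_eventually[OF flat_exp_tendsto[of m]])
       (auto simp: flat_exp_def eventually_at_right_field intro: gt_ex)
qed

lemma flat_exp_has_derivative:
  "(flat_exp m has_real_derivative flat_exp (m + 2) x - real m * flat_exp (m + 1) x) (at x)"
proof -
  consider "x < 0" | "x = 0" | "x > 0" by linarith
  then show ?thesis
  proof cases
    case 1
    have "((\<lambda>x. 0) has_real_derivative 0) (at x)" by simp
    then have "(flat_exp m has_real_derivative 0) (at x)"
      by (rule has_field_derivative_transform_within_open[where S = "{..<0}"]) (use 1 in \<open>auto simp: flat_exp_def\<close>)
    then show ?thesis using 1 by (simp add: flat_exp_def)
  next
    case 2
    have "(\<lambda>y. (flat_exp m y - flat_exp m 0) / (y - 0)) = flat_exp (m + 1)"
      by (auto simp: flat_exp_def fun_eq_iff divide_simps)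
    then show ?thesis using flat_exp_isolated_tendsto[of "m+1"] 2
      by (simp add: has_field_derivative_iff flat_exp_def[of _ 0])
  next
    case 3
    have "((\<lambda>x. exp (- inverse x) * inverse x ^ m) has_real_derivative
        flat_exp (m + 2) x - real m * flat_exp (m + 1) x) (at x)"
    proof -
      have "real m * inverse x ^ (m - 1) * (inverse x * inverse x) = real m * inverse x ^ (m + 1)"
        by (cases m) auto
      moreover have "((\<lambda>x. exp (- inverse x) * inverse x ^ m) has_real_derivative
          exp (- inverse x) * (inverse x * inverse x) * inverse x ^ m
            - exp (- inverse x) * (real m * inverse x ^ (m - 1) * (inverse x * inverse x))) (at x)"
        using 3 by (auto intro!: derivative_eq_intros simp: algebra_simps)
      moreover have "exp (- inverse x) * (inverse x * inverse x) * inverse x ^ m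
            - exp (- inverse x) * (real m * inverse x ^ (m + 1)) = flat_exp (m + 2) x - real m * flat_exp (m + 1) x"
        using 3 by (simp add: flat_exp_def algebra_simps)
      ultimately show ?thesis
        by (simp only:)
    qed
    then show ?thesis
      by (rule has_field_derivative_transform_within_open[where S = "{0<..}"]) (use 3 in \<open>auto simp: flat_exp_def\<close>)
  qed
qed

lemma Ck_flat_exp: "Ck k (flat_exp m)"
proof (induction k arbitrary: m)
  case 0
  show ?case
    using DERIV_isCont[OF flat_exp_has_derivative] by (simp add: continuous_at_imp_continuous_on)
next
  case (Suc k)
  show ?case
    by (rule Ck_Suc_real[OF flat_exp_has_derivative Ck_diff[OF Suc Ck_mult[OF Ck_const Suc]]])
qed

text \<open>
  A smooth transition from 0 on \<open>s \<le> -1\<close> to 1 on \<open>s \<ge> 1\<close>: the denominator is positive,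
  since at every point at least one of its two nonnegative summands is.
\<close>

definition smooth_step :: "real \<Rightarrow> real" where
  "smooth_step s = flat_exp 0 (s + 1) * inverse (flat_exp 0 (s + 1) + flat_exp 0 (1 - s))"

lemma smooth_smooth_step: "smooth smooth_step"
  unfolding smooth_def
proof
  fix k
  have ne: "flat_exp 0 (z + 1) + flat_exp 0 (1 - z) \<noteq> 0" for z :: real
  proof -
    have "flat_exp 0 (z + 1) \<ge> 0" "flat_exp 0 (1 - z) \<ge> 0" "flat_exp 0 (z + 1) > 0 \<or> flat_exp 0 (1 - z) > 0"
      by (auto simp: flat_exp_def)
    then show ?thesis by linarith
  qed
  have 1: "Ck k (\<lambda>s::real. flat_exp 0 (s + 1))"
    using Ck_affine[OF bounded_linear_ident Ck_flat_exp, of k 0 1] by simp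
  have 2: "Ck k (\<lambda>s::real. flat_exp 0 (1 - s))"
    using Ck_affine[OF bounded_linear_minus[OF bounded_linear_ident] Ck_flat_exp, of k 0 1] by simp
  show "Ck k smooth_step"
    unfolding smooth_step_def[abs_def] by (intro Ck_mult Ck_inverse Ck_add 1 2 ne)
qed

lemma smooth_step_0: "s \<le> -1 \<Longrightarrow> smooth_step s = 0"
  by (simp add: smooth_step_def flat_exp_def)

lemma smooth_step_1: "s \<ge> 1 \<Longrightarrow> smooth_step s = 1"
  by (simp add: smooth_step_def flat_exp_def)

lemma smooth_step_range: "0 \<le> smooth_step s" "smooth_step s \<le> 1"
proof -
  have "flat_exp 0 (s + 1) \<ge> 0" "flat_exp 0 (1 - s) \<ge> 0"
    by (auto simp: flat_exp_def)
  then show "0 \<le> smooth_step s" "smooth_step s \<le> 1"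
    unfolding smooth_step_def divide_inverse[symmetric] by (auto simp: divide_le_eq_1)
qed

lemma smooth_affine_smooth_step: "smooth (\<lambda>t. smooth_step (c * t + d))"
  unfolding smooth_def
proof
  fix k show "Ck k (\<lambda>t. smooth_step (c * t + d))"
    by (rule Ck_affine[OF bounded_linear_mult_right smooth_smooth_step[unfolded smooth_def, rule_format]])
qed

lemma smooth_step_affine_deriv:
  "((\<lambda>t. smooth_step (c * t + d)) has_real_derivative deriv smooth_step (c * t + d) * c) (at t)"
proof (rule DERIV_chain2[OF smooth_real_has_deriv[OF smooth_smooth_step]])
  show "((\<lambda>t. c * t + d) has_real_derivative c) (at t)"
    by (auto intro!: derivative_eq_intros)
qed

lemma smooth_step_deriv_0: "\<bar>s\<bar> > 1 \<Longrightarrow> deriv smooth_step s = 0"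
proof (cases "s > 1")
  case True
  have "((\<lambda>x. 1) has_real_derivative 0) (at s)" by simp
  then have "(smooth_step has_real_derivative 0) (at s)"
    by (rule has_field_derivative_transform_within_open[where S = "{1<..}"])
       (use True in \<open>auto simp: smooth_step_1\<close>)
  then show ?thesis by (rule DERIV_imp_deriv)
next
  case False
  assume "\<bar>s\<bar> > 1"
  with False show ?thesis
    by (intro deriv_zero_on_open[OF smooth_smooth_step, of "{..<-1}"]) (auto simp: smooth_step_0)
qed

lemma smooth_step_deriv_outside: "s \<notin> {-1..1} \<Longrightarrow> deriv smooth_step s = 0"
  by (rule smooth_step_deriv_0) (auto simp: abs_if)

lemma smooth_step_deriv2_0: "\<bar>s\<bar> > 1 \<Longrightarrow> deriv (deriv smooth_step) s = 0"
proof (rule deriv_zero_on_open[OF smooth_real_deriv[OF smooth_smooth_step]])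
  show "open {s::real. \<bar>s\<bar> > 1}" by (intro open_Collect_less continuous_intros)
qed (auto simp: smooth_step_deriv_0)

lemma integrable_smooth_step_deriv: "integrable lborel (deriv smooth_step)"
proof -
  have "integrable lborel (\<lambda>s. indicator {-1..1} s *\<^sub>R deriv smooth_step s)"
    by (intro borel_integrable_compact smooth_continuous smooth_real_deriv smooth_smooth_step) auto
  moreover have "(\<lambda>s. indicator {-1..1} s *\<^sub>R deriv smooth_step s) = deriv smooth_step"
    using smooth_step_deriv_outside by (auto simp: fun_eq_iff indicator_def)
  ultimately show ?thesis by simp
qed

lemma integral_smooth_step_deriv: "(LINT s|lborel. deriv smooth_step s) = 1"
proof -
  have "(LBINT s. deriv smooth_step s * indicator {-1..1} s) = smooth_step 1 - smooth_step (-1)"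
  proof (rule integral_FTC_Icc_real)
    show "(smooth_step has_real_derivative deriv smooth_step s) (at s)" for s
      by (rule smooth_real_has_deriv[OF smooth_smooth_step])
    show "isCont (deriv smooth_step) s" for s
      using smooth_continuous[OF smooth_real_deriv[OF smooth_smooth_step], of UNIV]
      by (simp add: continuous_on_eq_continuous_at)
  qed simp
  moreover have "(\<lambda>s. deriv smooth_step s * indicator {-1..1} s) = deriv smooth_step"
    using smooth_step_deriv_outside by (auto simp: fun_eq_iff indicator_def)
  ultimately show ?thesis by (simp add: smooth_step_0 smooth_step_1)
qed

text \<open>
  The derivative of the step is an integrable kernel of total mass 1, and its rescalings form an
  approximate identity.
\<close>

lemma smooth_step_concentrates:
  assumes f: "f \<in> borel_measurable borel" "\<And>t. \<bar>f t\<bar> \<le> B" "isCont f p"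
    and \<delta>: "\<And>n. \<delta> n > 0" "\<delta> \<longlonglongrightarrow> 0"
  shows "(\<lambda>n::nat. LINT t|lborel. deriv smooth_step ((t - p) / \<delta> n) / \<delta> n * f t) \<longlonglongrightarrow> f p"
proof -
  have eq: "(LINT t|lborel. deriv smooth_step ((t - p) / \<delta> n) / \<delta> n * f t) =
      (LINT y|lborel. deriv smooth_step y * f (p + \<delta> n * y))" for n
    using \<delta>(1)[of n]
    by (subst lborel_integral_real_affine[of "\<delta> n" _ p]) (auto simp: field_simps)
  have m: "deriv smooth_step \<in> borel_measurable borel"
    using borel_measurable_integrable[OF integrable_smooth_step_deriv] by simp
  have "(\<lambda>n. LINT y|lborel. deriv smooth_step y * f (p + \<delta> n * y)) \<longlonglongrightarrow>
      (LINT y|lborel. deriv smooth_step y * f p)"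
  proof (rule integral_dominated_convergence)
    show "integrable lborel (\<lambda>y. \<bar>deriv smooth_step y\<bar> * B)"
      using integrable_smooth_step_deriv by simp
    show "(\<lambda>y. deriv smooth_step y * f p) \<in> borel_measurable lborel"
      using m by simp
    show "(\<lambda>y. deriv smooth_step y * f (p + \<delta> n * y)) \<in> borel_measurable lborel" for n
      using m measurable_compose[OF _ f(1), of "\<lambda>y. p + \<delta> n * y" lborel] by simp
    show "AE y in lborel. (\<lambda>n. deriv smooth_step y * f (p + \<delta> n * y)) \<longlonglongrightarrow> deriv smooth_step y * f p"
    proof (intro AE_I2 tendsto_mult tendsto_const)
      fix y
      have "(\<lambda>n. p + \<delta> n * y) \<longlonglongrightarrow> p + 0 * y" by (intro tendsto_intros \<delta>)
      then show "(\<lambda>n. f (p + \<delta> n * y)) \<longlonglongrightarrow> f p"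
        using isCont_tendsto_compose[OF f(3)] by simp
    qed
    show "AE y in lborel. norm (deriv smooth_step y * f (p + \<delta> n * y)) \<le> \<bar>deriv smooth_step y\<bar> * B" for n
      by (intro AE_I2) (simp add: abs_mult mult_left_mono f(2))
  qed
  then show ?thesis unfolding eq by (simp add: integral_smooth_step_deriv)
qed

lemma smooth_step_scaled_tendsto:
  assumes \<delta>: "\<And>n. \<delta> n > 0" "\<delta> \<longlonglongrightarrow> 0" and "t \<noteq> p"
  shows "(\<lambda>n::nat. smooth_step ((t - p) / \<delta> n)) \<longlonglongrightarrow> indicator {p<..} t"
proof -
  have "\<forall>\<^sub>F n in sequentially. \<delta> n < \<bar>t - p\<bar>"
    using order_tendstoD(2)[OF \<delta>(2), of "\<bar>t - p\<bar>"] \<open>t \<noteq> p\<close> by simp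
  then have "\<forall>\<^sub>F n in sequentially. smooth_step ((t - p) / \<delta> n) = indicator {p<..} t"
  proof eventually_elim
    case (elim n)
    show ?case
    proof (cases "t > p")
      case True
      then have "(t - p) / \<delta> n \<ge> 1" using elim \<delta>(1)[of n] by (simp add: field_simps)
      then show ?thesis using True by (simp add: smooth_step_1)
    next
      case False
      then have "(t - p) / \<delta> n \<le> -1" using elim \<delta>(1)[of n] by (simp add: field_simps)
      then show ?thesis using False by (simp add: smooth_step_0)
    qed
  qed
  then show ?thesis by (rule tendsto_eventually)
qed


section \<open>Radial test functions\<close>

text \<open>
  The value 0 at the origin is prescribed separately because \<open>ln 0 = 0\<close> would otherwise give \<open>A 0\<close>.
\<close>

definition radial_ext :: "(real \<Rightarrow> real) \<Rightarrow> 'a::euclidean_space \<Rightarrow> real" where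
  "radial_ext A x = (if x = 0 then 0 else A (ln (norm x)))"

lemma exp_minus_2_ln: "r > 0 \<Longrightarrow> exp (- 2 * ln r) = 1 / r\<^sup>2" for r :: real
  using exp_of_nat_mult[of 2 "ln r"] by (simp add: exp_minus inverse_eq_divide)

text \<open>
  The factor \<open>1 / |x|\<^sup>2\<close> is written as an exponential of \<open>ln |x|\<close>, so that derivatives of functions of
  \<open>ln |x|\<close> remain of the same kind, up to linear factors.
\<close>

lemma ln_norm_has_derivative:
  fixes x :: "'a::euclidean_space"
  assumes "x \<noteq> 0"
  shows "((\<lambda>x. ln (norm x)) has_derivative (\<lambda>h. exp (- 2 * ln (norm x)) * (h \<bullet> x))) (at x)"
proof -
  have "((\<lambda>x. ln (norm x)) has_derivative (\<lambda>h. (h \<bullet> sgn x) * inverse (norm x))) (at x)"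
    using assms
    by (auto intro!: derivative_eq_intros has_derivative_norm simp: divide_inverse)
  moreover have "(h \<bullet> sgn x) * inverse (norm x) = exp (- 2 * ln (norm x)) * (h \<bullet> x)" for h
    using assms exp_minus_2_ln[of "norm x"]
    by (simp add: sgn_div_norm power2_eq_square divide_simps)
  ultimately show ?thesis by simp
qed

lemma radial_ext_has_derivative:
  fixes x :: "'a::euclidean_space"
  assumes A: "\<And>s. (A has_real_derivative A' s) (at s)" and zero: "\<And>s. s < c \<Longrightarrow> A s = 0"
  shows "(radial_ext A has_derivative (\<lambda>h. radial_ext (\<lambda>s. A' s * exp (- 2 * s)) x * (h \<bullet> x))) (at x)"
proof (cases "x = 0")
  case True
  \<comment> \<open>the function vanishes near the origin, namely on the ball of radius \<open>exp c\<close>\<close>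
  have "((\<lambda>x. 0) has_derivative (\<lambda>h. 0)) (at x)" by simp
  moreover have "radial_ext A y = 0" if "y \<in> ball 0 (exp c)" for y :: 'a
  proof (cases "y = 0")
    case False
    then have "ln (norm y) < c"
      using that ln_less_cancel_iff[of "norm y" "exp c"] by simp
    then show ?thesis using zero by (simp add: radial_ext_def)
  qed (simp add: radial_ext_def)
  ultimately have "(radial_ext A has_derivative (\<lambda>h. 0)) (at x)"
    using True by - (rule has_derivative_transform_within_open[where s = "ball 0 (exp c)"], simp_all)
  then show ?thesis using True by (simp add: radial_ext_def)
next
  case False
  have "((\<lambda>x. A (ln (norm x))) has_derivative
      (\<lambda>h. A' (ln (norm x)) * (exp (- 2 * ln (norm x)) * (h \<bullet> x)))) (at x)"
    by (rule has_derivative_compose[OF ln_norm_has_derivative[OF False]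
          A[unfolded has_field_derivative_def]])
  then have "(radial_ext A has_derivative
      (\<lambda>h. A' (ln (norm x)) * (exp (- 2 * ln (norm x)) * (h \<bullet> x)))) (at x)"
    by (rule has_derivative_transform_within_open[where s = "- {0}"])
       (use False in \<open>auto simp: radial_ext_def\<close>)
  then show ?thesis using False by (simp add: radial_ext_def mult.assoc)
qed

text \<open>
  Each differentiation replaces the profile \<open>A\<close> by \<open>A' exp (-2 s)\<close>, which vanishes on the same left half-line,
  and multiplies by a linear function; the induction is therefore over all profiles.
\<close>

lemma Ck_radial_ext:
  assumes "Ck k A" "\<And>s. s < c \<Longrightarrow> A s = 0"
  shows "Ck k (radial_ext A :: 'a::euclidean_space \<Rightarrow> real)"
  using assms
proof (induction k arbitrary: A)
  case 0
  have "isCont (radial_ext A) x" for x :: 'a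
  proof (cases "x = 0")
    case True
    have "\<forall>\<^sub>F y in nhds x. y \<in> ball 0 (exp c)"
      by (rule eventually_nhds_in_open) (use True in auto)
    then have "\<forall>\<^sub>F y in nhds x. radial_ext A y = 0"
    proof eventually_elim
      case (elim y)
      then show ?case using 0(2)[of "ln (norm y)"] ln_less_cancel_iff[of "norm y" "exp c"]
        by (auto simp: radial_ext_def)
    qed
    then show ?thesis
      using isCont_cong[of "radial_ext A" "\<lambda>_. 0" x] by simp
  next
    case False
    have "isCont (\<lambda>x. A (ln (norm x))) x"
      by (rule isCont_o2[where g = A]) (use False 0 in \<open>auto intro!: continuous_intros simp: continuous_on_eq_continuous_at\<close>)
    moreover have "\<forall>\<^sub>F y in nhds x. y \<in> - {0}"
      by (rule eventually_nhds_in_open) (use False in auto)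
    then have "\<forall>\<^sub>F y in nhds x. radial_ext A y = A (ln (norm y))"
      by eventually_elim (simp add: radial_ext_def)
    ultimately show ?thesis
      using isCont_cong[of "radial_ext A" "\<lambda>x. A (ln (norm x))" x] by simp
  qed
  then show ?case by (simp add: continuous_at_imp_continuous_on)
next
  case (Suc k)
  define A' where "A' = dir_deriv 1 A"
  have "(A has_derivative (\<lambda>v. dir_deriv v A s)) (at s)" for s
    by (rule Ck_Suc_has_derivative[OF Suc.prems(1)])
  moreover have "dir_deriv v A s = A' s * v" for v s
    using linear_scale[OF has_derivative_linear[OF \<open>(A has_derivative (\<lambda>v. dir_deriv v A s)) (at s)\<close>], of v 1]
    by (simp add: A'_def)
  ultimately have A': "(A has_real_derivative A' s) (at s)" for s
    by (simp add: has_field_derivative_def)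
  have 0: "A' s = 0" if "s < c" for s
    by (rule derivative_zero_on_open[OF A', where S = "{..<c}"]) (use that Suc.prems(2) in auto)
  have "Ck k A'" using Suc.prems(1) by (simp add: A'_def)
  then have "Ck k (radial_ext (\<lambda>s. A' s * exp (- 2 * s)) :: 'a \<Rightarrow> real)"
    by (intro Suc.IH Ck_mult Ck_exp) (simp_all add: 0)
  moreover have "Ck k (\<lambda>x::'a. v \<bullet> x)" for v
    by (rule Ck_linear[OF bounded_linear_inner_right])
  ultimately show ?case
    by (intro Ck_SucI[OF radial_ext_has_derivative[OF A' Suc.prems(2)]] Ck_mult)
qed

definition radial_test :: "(real \<Rightarrow> real) \<Rightarrow> (real \<Rightarrow> real) \<Rightarrow> 'a::euclidean_space \<times> real \<Rightarrow> real" where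
  "radial_test A \<theta> z = radial_ext A (fst z) * \<theta> (snd z)"

lemma smooth_radial_test:
  assumes "smooth A" "smooth \<theta>" "\<And>s. s < c \<Longrightarrow> A s = 0"
  shows "smooth (radial_test A \<theta>)"
  unfolding smooth_def
proof
  fix k
  have "Ck k (\<lambda>z::'a \<times> real. radial_ext A (fst z + 0))" "Ck k (\<lambda>z::'a \<times> real. \<theta> (snd z + 0))"
    using assms by (auto intro!: Ck_affine Ck_radial_ext bounded_linear_fst bounded_linear_snd simp: smooth_def simp del: add_0_right)
  then show "Ck k (radial_test A \<theta> :: 'a \<times> real \<Rightarrow> real)"
    unfolding radial_test_def[abs_def] by (intro Ck_mult) auto
qed

lemma test_function_radial_test:
  assumes "smooth A" "smooth \<theta>"
    and A: "\<And>s. \<bar>s\<bar> > R \<Longrightarrow> A s = 0"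
    and \<theta>: "\<And>t. t \<notin> {a..b} \<Longrightarrow> \<theta> t = 0" and "0 < a"
  shows "test_function Q (radial_test A \<theta> :: 'a::euclidean_space \<times> real \<Rightarrow> real)"
proof -
  let ?K = "cball 0 (exp R) \<times> {a..b} :: ('a \<times> real) set"
  have "compact ?K" by (intro compact_Times compact_cball) auto
  moreover have "{z :: 'a \<times> real. radial_test A \<theta> z \<noteq> 0} \<subseteq> ?K"
  proof clarsimp
    fix x :: 'a and t assume *: "radial_test A \<theta> (x, t) \<noteq> 0"
    then have "x \<noteq> 0" "A (ln (norm x)) \<noteq> 0" "\<theta> t \<noteq> 0"
      by (auto simp: radial_test_def radial_ext_def split: if_splits)
    moreover from this have "ln (norm x) \<le> R" using A[of "ln (norm x)"] by fastforce
    ultimately show "norm x \<le> exp R \<and> a \<le> t \<and> t \<le> b"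
      using \<theta>[of t] exp_le_cancel_iff[of "ln (norm x)" R] by auto
  qed
  ultimately have "closure {z :: 'a \<times> real. radial_test A \<theta> z \<noteq> 0} \<subseteq> ?K"
    by (simp add: closure_minimal compact_imp_closed)
  moreover from this have "compact (closure {z :: 'a \<times> real. radial_test A \<theta> z \<noteq> 0})"
    using bounded_subset[OF compact_imp_bounded[OF \<open>compact ?K\<close>]]
    by (meson closure_subset compact_closure subset_trans)
  moreover have "?K \<subseteq> Q" using \<open>0 < a\<close> by (auto simp: Q_def)
  ultimately show ?thesis
    using smooth_radial_test[OF assms(1,2), of "-R"] A unfolding test_function_def by force
qed

lemma radial_test_has_derivative:
  fixes z :: "'a::euclidean_space \<times> real"
  assumes "smooth A" "smooth \<theta>" "\<And>s. s < c \<Longrightarrow> A s = 0"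
  shows "(radial_test A \<theta> has_derivative
     (\<lambda>h. radial_test (\<lambda>s. deriv A s * exp (- 2 * s)) \<theta> z * (fst h \<bullet> fst z) +
       radial_test A (deriv \<theta>) z * snd h)) (at z)"
proof -
  have 1: "((\<lambda>z::'a \<times> real. radial_ext A (fst z)) has_derivative
      (\<lambda>h. radial_ext (\<lambda>s. deriv A s * exp (- 2 * s)) (fst z) * (fst h \<bullet> fst z))) (at z)"
    by (rule has_derivative_compose[OF has_derivative_fst[OF has_derivative_ident]
          radial_ext_has_derivative[OF smooth_real_has_deriv[OF assms(1)] assms(3)]])
  have 2: "((\<lambda>z::'a \<times> real. \<theta> (snd z)) has_derivative (\<lambda>h. deriv \<theta> (snd z) * snd h)) (at z)"
    by (rule has_derivative_compose[OF has_derivative_snd[OF has_derivative_ident]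
          smooth_real_has_deriv[OF assms(2), unfolded has_field_derivative_def]])
  show ?thesis
    unfolding radial_test_def[abs_def]
    by (rule has_derivative_eq_rhs[OF has_derivative_mult[OF 1 2]]) (auto simp: algebra_simps)
qed

lemma time_deriv_radial_test:
  assumes "smooth A" "smooth \<theta>" "\<And>s. s < c \<Longrightarrow> A s = 0"
  shows "time_deriv (radial_test A \<theta>) z = radial_test A (deriv \<theta>) z"
  unfolding time_deriv_def by (subst dir_derivI[OF radial_test_has_derivative[OF assms]]) auto

text \<open>
  The Laplacian of a function of \<open>ln |x|\<close>: it has constant coefficients after multiplication by \<open>|x|\<^sup>2\<close>,
  the inverse of the weight in front of the time derivative.
\<close>

lemma laplacian_radial_test:
  fixes z :: "'a::euclidean_space \<times> real"
  assumes "smooth A" "smooth \<theta>" "\<And>s. s < c \<Longrightarrow> A s = 0"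
  shows "laplacian (radial_test A \<theta>) z =
    radial_test (\<lambda>s. (deriv (deriv A) s + (real DIM('a) - 2) * deriv A s) * exp (- 2 * s)) \<theta> z"
proof -
  define B where "B = (\<lambda>s. deriv A s * exp (- 2 * s))"
  have B: "smooth B"
    unfolding B_def by (intro smooth_mult_exp smooth_real_deriv assms)
  have B0: "B s = 0" if "s < c" for s
    using deriv_zero_on_open[OF assms(1), of "{..<c}" s] assms(3) that by (auto simp: B_def)
  have B': "deriv B s = (deriv (deriv A) s - 2 * deriv A s) * exp (- 2 * s)" for s
    unfolding B_def
    by (rule DERIV_imp_deriv)
       (auto intro!: derivative_eq_intros smooth_real_has_deriv smooth_real_deriv assms simp: algebra_simps)
  have 1: "dir_deriv (b, 0) (radial_test A \<theta>) = (\<lambda>z. radial_test B \<theta> z * (b \<bullet> fst z))" for b :: 'a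
    by (rule ext, subst dir_derivI[OF radial_test_has_derivative[OF assms]]) (auto simp: B_def)
  have 2: "dir_deriv (b, 0) (\<lambda>z. radial_test B \<theta> z * (b \<bullet> fst z)) z =
      radial_test B \<theta> z * (b \<bullet> b) +
      radial_test (\<lambda>s. deriv B s * exp (- 2 * s)) \<theta> z * (b \<bullet> fst z)\<^sup>2" for b :: 'a
  proof -
    have "((\<lambda>z::'a \<times> real. b \<bullet> fst z) has_derivative (\<lambda>h. b \<bullet> fst h)) (at z)"
      by (intro derivative_intros)
    from dir_derivI[OF has_derivative_mult[OF radial_test_has_derivative[OF B assms(2) B0] this], where v = "(b, 0)"]
    show ?thesis by (simp add: power2_eq_square algebra_simps)
  qed
  have "laplacian (radial_test A \<theta>) z = radial_test B \<theta> z * real DIM('a) +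
      radial_test (\<lambda>s. deriv B s * exp (- 2 * s)) \<theta> z * (\<Sum>b\<in>Basis. (b \<bullet> fst z)\<^sup>2)"
    unfolding laplacian_def 1 2 by (simp del: mult_cancel_left mult_cancel_right add: sum.distrib sum_distrib_left)
  also have "(\<Sum>b\<in>Basis. (b \<bullet> fst z)\<^sup>2) = (norm (fst z))\<^sup>2"
    unfolding power2_norm_eq_inner euclidean_inner[of "fst z" "fst z"]
    by (simp add: power2_eq_square inner_commute)
  also have "radial_test (\<lambda>s. deriv B s * exp (- 2 * s)) \<theta> z * (norm (fst z))\<^sup>2 =
      radial_test (deriv B) \<theta> z"
    using exp_minus_2_ln[of "norm (fst z)"]
    by (auto simp: radial_test_def radial_ext_def)
  also have "radial_test B \<theta> z * real DIM('a) + radial_test (deriv B) \<theta> z =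
      radial_test (\<lambda>s. (deriv (deriv A) s + (real DIM('a) - 2) * deriv A s) * exp (- 2 * s)) \<theta> z"
    by (auto simp: radial_test_def radial_ext_def B' B_def[THEN fun_cong] algebra_simps)
  finally show ?thesis .
qed


section \<open>Moments in the logarithm of the norm\<close>

text \<open>
  The integral of \<open>k\<close> with respect to the image under \<open>ln |x|\<close> of the measure \<open>h(x) / |x|\<^sup>2 dx\<close>.
  With \<open>k\<close> a sine or cosine this is the Fourier transform in the variable in which the equation
  has constant coefficients.
\<close>

definition log_moment :: "('a::euclidean_space \<Rightarrow> real) \<Rightarrow> (real \<Rightarrow> real) \<Rightarrow> real" where
  "log_moment h k = (LINT x|lebesgue. h x * k (ln (norm x)) / (norm x)\<^sup>2)"

lemma borel_measurable_ln_norm: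
  fixes k :: "real \<Rightarrow> 'c::topological_space"
  assumes "k \<in> borel_measurable borel"
  shows "(\<lambda>x::'a::euclidean_space. k (ln (norm x))) \<in> borel_measurable lebesgue"
proof -
  have "(\<lambda>x::'a. k (ln (norm x))) \<in> borel_measurable borel"
    by (rule measurable_compose[OF _ assms]) measurable
  then show ?thesis by (simp add: measurable_completion)
qed

lemma in_L12_log_integrable:
  assumes h: "in_L12 h" and k: "k \<in> borel_measurable borel" "\<And>s. \<bar>k s\<bar> \<le> C"
  shows "integrable lebesgue (\<lambda>x. h x * k (ln (norm x)) / (norm x)\<^sup>2)"
proof (rule Bochner_Integration.integrable_bound)
  show "integrable lebesgue (\<lambda>x. C * (\<bar>h x\<bar> / (norm x)\<^sup>2))"
    using h unfolding in_L12_def by (intro integrable_mult_right) blast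
  have [measurable]: "h \<in> borel_measurable lebesgue" "(\<lambda>x. k (ln (norm x))) \<in> borel_measurable (lebesgue :: 'a measure)"
    "(\<lambda>x. (norm x)\<^sup>2) \<in> borel_measurable (lebesgue :: 'a measure)"
    using h borel_measurable_ln_norm[OF k(1)] by (auto simp: in_L12_def intro!: measurable_completion)
  show "(\<lambda>x. h x * k (ln (norm x)) / (norm x)\<^sup>2) \<in> borel_measurable lebesgue" by measurable
  have "\<bar>h x\<bar> * \<bar>k (ln (norm x))\<bar> \<le> C * \<bar>h x\<bar>" for x
    using mult_left_mono[OF k(2)[of "ln (norm x)"], of "\<bar>h x\<bar>"] by (simp add: mult.commute)
  moreover have "0 \<le> C" using k(2)[of 0] by linarith
  ultimately show "AE x in lebesgue. norm (h x * k (ln (norm x)) / (norm x)\<^sup>2) \<le> norm (C * (\<bar>h x\<bar> / (norm x)\<^sup>2))"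
    by (intro AE_I2) (simp add: abs_mult divide_right_mono)
qed

lemma in_L12_diff:
  assumes "in_L12 f" "in_L12 g"
  shows "in_L12 (\<lambda>x. f x - g x)"
  unfolding in_L12_def
proof
  have [measurable]: "f \<in> borel_measurable lebesgue" "g \<in> borel_measurable lebesgue"
    "(\<lambda>x. (norm x)\<^sup>2) \<in> borel_measurable (lebesgue :: 'a measure)"
    using assms by (auto simp: in_L12_def intro!: measurable_completion)
  show "(\<lambda>x. f x - g x) \<in> borel_measurable lebesgue" by measurable
  show "integrable lebesgue (\<lambda>x. \<bar>f x - g x\<bar> / (norm x)\<^sup>2)"
  proof (rule Bochner_Integration.integrable_bound)
    show "integrable lebesgue (\<lambda>x. \<bar>f x\<bar> / (norm x)\<^sup>2 + \<bar>g x\<bar> / (norm x)\<^sup>2)"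
      using assms by (auto simp: in_L12_def)
    show "(\<lambda>x. \<bar>f x - g x\<bar> / (norm x)\<^sup>2) \<in> borel_measurable lebesgue" by measurable
    show "AE x in lebesgue. norm (\<bar>f x - g x\<bar> / (norm x)\<^sup>2) \<le> norm (\<bar>f x\<bar> / (norm x)\<^sup>2 + \<bar>g x\<bar> / (norm x)\<^sup>2)"
      by (intro AE_I2) (auto simp: add_divide_distrib[symmetric] intro!: divide_right_mono)
  qed
qed

lemma log_moment_diff_le:
  assumes "in_L12 f" "in_L12 g" and k: "k \<in> borel_measurable borel" "\<And>s. \<bar>k s\<bar> \<le> C"
  shows "\<bar>log_moment f k - log_moment g k\<bar> \<le> C * L12_norm (\<lambda>x. f x - g x)"
proof -
  have d: "in_L12 (\<lambda>x. f x - g x)" by (rule in_L12_diff[OF assms(1,2)])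
  have "log_moment f k - log_moment g k = log_moment (\<lambda>x. f x - g x) k"
    unfolding log_moment_def
    using Bochner_Integration.integral_diff[OF in_L12_log_integrable[OF assms(1) k] in_L12_log_integrable[OF assms(2) k]]
    by (simp only: left_diff_distrib diff_divide_distrib)
  also have "\<bar>\<dots>\<bar> \<le> (LINT x|lebesgue. \<bar>(f x - g x) * k (ln (norm x)) / (norm x)\<^sup>2\<bar>)"
    unfolding log_moment_def by (rule integral_abs_bound)
  also have "\<dots> \<le> (LINT x|lebesgue. C * (\<bar>f x - g x\<bar> / (norm x)\<^sup>2))"
  proof (rule integral_mono)
    show "integrable lebesgue (\<lambda>x. \<bar>(f x - g x) * k (ln (norm x)) / (norm x)\<^sup>2\<bar>)"
      by (rule integrable_abs[OF in_L12_log_integrable[OF d k]])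
    show "integrable lebesgue (\<lambda>x. C * (\<bar>f x - g x\<bar> / (norm x)\<^sup>2))"
      using d unfolding in_L12_def by (intro integrable_mult_right) blast
    show "\<bar>(f x - g x) * k (ln (norm x)) / (norm x)\<^sup>2\<bar> \<le> C * (\<bar>f x - g x\<bar> / (norm x)\<^sup>2)" for x
      using mult_left_mono[OF k(2)[of "ln (norm x)"], of "\<bar>f x - g x\<bar>"]
      by (simp add: mult.commute abs_mult divide_right_mono)
  qed
  also have "\<dots> = C * L12_norm (\<lambda>x. f x - g x)"
    unfolding L12_norm_def by (rule integral_mult_right_zero)
  finally show ?thesis .
qed

lemma log_moment_abs_le:
  assumes "in_L12 f" and k: "k \<in> borel_measurable borel" "\<And>s. \<bar>k s\<bar> \<le> C"
  shows "\<bar>log_moment f k\<bar> \<le> C * L12_norm f"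
  using log_moment_diff_le[OF assms(1) _ k, of "\<lambda>x. 0"]
  by (simp add: in_L12_def log_moment_def)

lemma log_moment_linear:
  assumes f: "in_L12 f" and k: "k \<in> borel_measurable borel" "\<And>s. \<bar>k s\<bar> \<le> C"
    and l: "l \<in> borel_measurable borel" "\<And>s. \<bar>l s\<bar> \<le> D"
  shows "log_moment f (\<lambda>s. c * k s + d * l s) = c * log_moment f k + d * log_moment f l"
proof -
  have eq: "f x * (c * k (ln (norm x)) + d * l (ln (norm x))) / (norm x)\<^sup>2 =
      c * (f x * k (ln (norm x)) / (norm x)\<^sup>2) + d * (f x * l (ln (norm x)) / (norm x)\<^sup>2)" for x
    by (simp add: add_divide_distrib algebra_simps)
  show ?thesis
    unfolding log_moment_def eq
    by (subst Bochner_Integration.integral_add)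
       (simp_all only: integral_mult_right_zero integrable_mult_right
         in_L12_log_integrable[OF f k] in_L12_log_integrable[OF f l])
qed

lemma log_moment_cong_AE:
  assumes "in_L12 f" "in_L12 g" "AE x in lebesgue. f x = g x" and k: "k \<in> borel_measurable borel" "\<And>s. \<bar>k s\<bar> \<le> C"
  shows "log_moment f k = log_moment g k"
  unfolding log_moment_def
proof (rule Bochner_Integration.integral_cong_AE)
  show "AE x in lebesgue. f x * k (ln (norm x)) / (norm x)\<^sup>2 = g x * k (ln (norm x)) / (norm x)\<^sup>2"
    using assms(3) by eventually_elim simp
qed (intro borel_measurable_integrable in_L12_log_integrable[OF assms(1) k] in_L12_log_integrable[OF assms(2) k])+

lemma log_moment_tendsto:
  fixes k :: "nat \<Rightarrow> real \<Rightarrow> real"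
  assumes f: "in_L12 f" and k: "\<And>n. k n \<in> borel_measurable borel" "\<And>n s. \<bar>k n s\<bar> \<le> C"
    and l: "l \<in> borel_measurable borel" "\<And>s. (\<lambda>n. k n s) \<longlonglongrightarrow> l s"
  shows "(\<lambda>n. log_moment f (k n)) \<longlonglongrightarrow> log_moment f l"
proof -
  have lC: "\<bar>l s\<bar> \<le> C" for s
    using LIMSEQ_le_const2[OF tendsto_rabs[OF l(2)[of s]]] k(2) by blast
  show ?thesis
    unfolding log_moment_def
  proof (rule integral_dominated_convergence)
    show "integrable lebesgue (\<lambda>x. C * (\<bar>f x\<bar> / (norm x)\<^sup>2))"
      using f unfolding in_L12_def by (intro integrable_mult_right) blast
    show "(\<lambda>x. f x * l (ln (norm x)) / (norm x)\<^sup>2) \<in> borel_measurable lebesgue"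
      by (rule borel_measurable_integrable[OF in_L12_log_integrable[OF f l(1) lC]])
    show "(\<lambda>x. f x * k n (ln (norm x)) / (norm x)\<^sup>2) \<in> borel_measurable lebesgue" for n
      by (rule borel_measurable_integrable[OF in_L12_log_integrable[OF f k]])
    show "AE x in lebesgue. (\<lambda>n. f x * k n (ln (norm x)) / (norm x)\<^sup>2) \<longlonglongrightarrow> f x * l (ln (norm x)) / (norm x)\<^sup>2"
      by (intro AE_I2) (simp only: divide_inverse, intro tendsto_intros l)
    show "AE x in lebesgue. norm (f x * k n (ln (norm x)) / (norm x)\<^sup>2) \<le> C * (\<bar>f x\<bar> / (norm x)\<^sup>2)" for n
    proof (rule AE_I2)
      fix x :: 'a
      have "\<bar>f x\<bar> * \<bar>k n (ln (norm x))\<bar> \<le> C * \<bar>f x\<bar>"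
        using mult_left_mono[OF k(2)[of n "ln (norm x)"], of "\<bar>f x\<bar>"] by (simp add: mult.commute)
      then show "norm (f x * k n (ln (norm x)) / (norm x)\<^sup>2) \<le> C * (\<bar>f x\<bar> / (norm x)\<^sup>2)"
        by (simp add: abs_mult divide_right_mono)
    qed
  qed
qed

text \<open>
  Continuity in time with values in the weighted space holds up to time 0; this is what attaches the
  initial datum to the evolution of the moments.
\<close>

lemma continuous_on_log_moment:
  assumes u: "continuous_in_L12 u" and k: "k \<in> borel_measurable borel" "\<And>s. \<bar>k s\<bar> \<le> C"
  shows "continuous_on {0..} (\<lambda>t. log_moment (\<lambda>x. u x t) k)"
  unfolding continuous_on_def
proof
  fix s :: real assume s: "s \<in> {0..}"
  have lim: "((\<lambda>t. C * L12_norm (\<lambda>x. u x t - u x s)) \<longlongrightarrow> C * 0) (at s within {0..})"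
    using u s by (intro tendsto_intros) (auto simp: continuous_in_L12_def)
  have bound: "\<forall>\<^sub>F t in at s within {0..}.
     norm (log_moment (\<lambda>x. u x t) k - log_moment (\<lambda>x. u x s) k) \<le> C * L12_norm (\<lambda>x. u x t - u x s)"
    unfolding eventually_at_filter
  proof (intro always_eventually allI impI)
    fix t :: real assume "t \<in> {0..}"
    then have "in_L12 (\<lambda>x. u x t)" "in_L12 (\<lambda>x. u x s)"
      using s u by (auto simp: continuous_in_L12_def)
    from log_moment_diff_le[OF this k]
    show "norm (log_moment (\<lambda>x. u x t) k - log_moment (\<lambda>x. u x s) k) \<le> C * L12_norm (\<lambda>x. u x t - u x s)"
      by simp
  qed
  have "((\<lambda>t. log_moment (\<lambda>x. u x t) k - log_moment (\<lambda>x. u x s) k) \<longlongrightarrow> 0) (at s within {0..})"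
    by (rule Lim_null_comparison[OF bound lim[unfolded mult_zero_right]])
  then show "((\<lambda>t. log_moment (\<lambda>x. u x t) k) \<longlongrightarrow> log_moment (\<lambda>x. u x s) k) (at s within {0..})"
    by (rule LIM_zero_cancel)
qed


section \<open>The weak evolution equation of the moments\<close>

lemma integrable_mult_bounded:
  fixes W v :: "'b \<Rightarrow> real"
  assumes "integrable M W" "v \<in> borel_measurable M" "\<And>z. \<bar>v z\<bar> \<le> K"
  shows "integrable M (\<lambda>z. W z * v z)"
proof (rule Bochner_Integration.integrable_bound)
  show "integrable M (\<lambda>z. K * W z)" using assms(1) by simp
  show "(\<lambda>z. W z * v z) \<in> borel_measurable M"
    using assms(2) borel_measurable_integrable[OF assms(1)] by simp
  have "\<bar>W z\<bar> * \<bar>v z\<bar> \<le> \<bar>K\<bar> * \<bar>W z\<bar>" for z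
    using mult_left_mono[of "\<bar>v z\<bar>" "\<bar>K\<bar>" "\<bar>W z\<bar>"] assms(3)[of z] by (simp add: mult.commute)
  then show "AE z in M. norm (W z * v z) \<le> norm (K * W z)"
    by (simp add: abs_mult)
qed

lemma AE_lborel_slices:
  assumes "AE z in (lborel :: ('a::euclidean_space \<times> 'b::euclidean_space) measure). P z"
  shows "AE y in lborel. AE x in lborel. P (x, y)"
proof -
  from assms obtain N where N: "N \<in> null_sets (lborel :: ('a \<times> 'b) measure)" "\<And>z. \<not> P z \<Longrightarrow> z \<in> N"
    unfolding eventually_ae_filter by auto
  have "AE z in lborel \<Otimes>\<^sub>M lborel. z \<notin> N"
    unfolding lborel_prod by (rule AE_not_in[OF N(1)])
  then have "AE x in lborel. AE y in lborel. (x, y) \<notin> N"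
    by (rule lborel_pair.AE_pair)
  moreover have "N \<in> sets borel" using N(1) by auto
  then have "{x \<in> space (lborel \<Otimes>\<^sub>M lborel). (fst x, snd x) \<notin> N} \<in> sets (lborel \<Otimes>\<^sub>M lborel :: ('a \<times> 'b) measure)"
    unfolding lborel_prod using borel_comp[of N] by (simp add: Compl_eq)
  ultimately have "AE y in lborel. AE x in lborel. (x, y) \<notin> N"
    using lborel_pair.AE_commute[of "\<lambda>x y. (x, y) \<notin> N"] by simp
  then show ?thesis
  proof eventually_elim
    case (elim y)
    then show ?case by eventually_elim (use N(2) in blast)
  qed
qed

lemma in_Linfty_bounded:
  assumes "in_Linfty M f"
  obtains K where "AE z in M. \<bar>f z\<bar> \<le> K"
proof -
  obtain n :: nat where n: "Linfty_norm M f < ereal (real n)"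
    using assms less_PInf_Ex_of_nat[of "Linfty_norm M f"] by (auto simp: in_Linfty_def)
  have "AE z in M. ereal \<bar>f z\<bar> \<le> Linfty_norm M f"
    unfolding Linfty_norm_def by (rule esssup_AE)
  then have "AE z in M. \<bar>f z\<bar> \<le> real n"
  proof eventually_elim
    case (elim z)
    then have "ereal \<bar>f z\<bar> < ereal (real n)" using n by (rule le_less_trans)
    then show ?case by simp
  qed
  then show ?thesis by (rule that)
qed

text \<open>
  Truncation at an essential bound turns a Borel version into one that is bounded everywhere.
\<close>

lemma in_Linfty_borel_representative:
  fixes f :: "'b::euclidean_space \<Rightarrow> real"
  assumes f: "in_Linfty (lebesgue_on S) f" and S: "S \<in> sets borel"
  obtains v K where "v \<in> borel_measurable borel" "\<And>z. \<bar>v z\<bar> \<le> K"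
    "AE z in lborel. z \<in> S \<longrightarrow> v z = f z"
proof -
  have S': "S \<in> sets lebesgue" using S by simp
  obtain K where K: "AE z in lebesgue_on S. \<bar>f z\<bar> \<le> K"
    using in_Linfty_bounded[OF f] .
  then have K': "AE z in lborel. z \<in> S \<longrightarrow> \<bar>f z\<bar> \<le> K"
    using S' by (subst (asm) AE_restrict_space_iff) (auto simp: AE_completion_iff)
  have "(\<lambda>z. indicator S z *\<^sub>R f z) \<in> borel_measurable (completion lborel)"
    using f S' by (subst borel_measurable_restrict_space_iff[symmetric]) (auto simp: in_Linfty_def)
  from completion_ex_borel_measurable_real[OF this]
  obtain w where w[measurable]: "w \<in> borel_measurable borel" and w': "AE z in lborel. indicator S z *\<^sub>R f z = w z"
    by auto
  define v where "v z = max (- \<bar>K\<bar>) (min \<bar>K\<bar> (w z))" for z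
  show ?thesis
  proof (rule that)
    show "v \<in> borel_measurable borel" unfolding v_def by measurable
    show "\<bar>v z\<bar> \<le> \<bar>K\<bar>" for z unfolding v_def by linarith
    show "AE z in lborel. z \<in> S \<longrightarrow> v z = f z"
      using w' K' by eventually_elim (auto simp: v_def max_def min_def)
  qed
qed

text \<open>
  Testing the equation with \<open>A (ln |x|) * \<theta> t\<close> and integrating in \<open>x\<close> first.  Since the Laplacian of the test
  function carries the factor \<open>1 / |x|\<^sup>2\<close> as well, the whole integrand is a moment, and the identity says
  that the moment of \<open>A\<close> has, in the weak sense, the moment of \<open>A'' + (N - 2) A'\<close> as its time derivative.
  Boundedness of the solution at positive times makes the integrand integrable over space-time.
\<close>

lemma weak_solution_radial_test:
  fixes u :: "'a::euclidean_space \<Rightarrow> real \<Rightarrow> real"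
  assumes u: "weak_solution u0 u"
    and A: "smooth A" "\<And>s. \<bar>s\<bar> > R \<Longrightarrow> A s = 0"
    and \<theta>: "smooth \<theta>" "\<And>t. t \<notin> {a..b} \<Longrightarrow> \<theta> t = 0" and "0 < a"
  shows "(LINT t|lborel. deriv \<theta> t * log_moment (\<lambda>x. u x t) A +
     \<theta> t * log_moment (\<lambda>x. u x t) (\<lambda>s. deriv (deriv A) s + (real DIM('a) - 2) * deriv A s)) = 0"
proof -
  define L where "L s = deriv (deriv A) s + (real DIM('a) - 2) * deriv A s" for s
  \<comment> \<open>\<open>w\<close> plays the role of \<open>1 / (norm x)\<^sup>2\<close>; keeping it smooth makes \<open>W\<close> continuous, hence integrable\<close>
  define w where "w = (\<lambda>s::real. exp (- 2 * s))"
  define W where "W z = radial_test (\<lambda>s. L s * w s) \<theta> z + radial_test (\<lambda>s. A s * w s) (deriv \<theta>) z"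
    for z :: "'a \<times> real"
  have A1: "smooth (deriv A)" "smooth (deriv (deriv A))" and \<theta>1: "smooth (deriv \<theta>)"
    by (intro smooth_real_deriv A \<theta>)+
  have L: "smooth L"
    using A1 unfolding L_def[abs_def] smooth_def by (auto intro!: Ck_add Ck_mult Ck_const)
  have Lw: "smooth (\<lambda>s. L s * w s)" and Aw: "smooth (\<lambda>s. A s * w s)"
    unfolding w_def using smooth_mult_exp[OF L, of "-2"] smooth_mult_exp[OF A(1), of "-2"] by simp_all
  have op: "open {s::real. \<bar>s\<bar> > R}" by (intro open_Collect_less continuous_intros)
  have A10: "deriv A s = 0" if "\<bar>s\<bar> > R" for s
    by (rule deriv_zero_on_open[OF A(1) op]) (use that A(2) in auto)
  have "deriv (deriv A) s = 0" if "\<bar>s\<bar> > R" for s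
    by (rule deriv_zero_on_open[OF A1(1) op]) (use that A10 in auto)
  with A10 have L0: "L s = 0" if "\<bar>s\<bar> > R" for s using that by (simp add: L_def)
  have \<theta>10: "deriv \<theta> t = 0" if "t \<notin> {a..b}" for t
    by (rule deriv_zero_on_open[OF \<theta>(1), of "- {a..b}"]) (use that \<theta>(2) in auto)
  have supp: "radial_test A' \<theta>' z = 0" if "z \<notin> cball 0 (exp R) \<times> {a..b}"
      "\<And>s. \<bar>s\<bar> > R \<Longrightarrow> A' s = 0" "\<And>t. t \<notin> {a..b} \<Longrightarrow> \<theta>' t = 0" for A' \<theta>' and z :: "'a \<times> real"
  proof -
    obtain x t where z: "z = (x, t)" by fastforce
    have "A' (ln (norm x)) = 0" if "norm x > exp R"
    proof -
      have "norm x > 0" using that exp_gt_zero[of R] by linarith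
      then have "ln (norm x) > R" using that ln_less_cancel_iff[of "exp R" "norm x"] by simp
      then show ?thesis by (intro \<open>\<And>s. \<bar>s\<bar> > R \<Longrightarrow> A' s = 0\<close>) auto
    qed
    then show ?thesis using that(1) that(3)[of t]
      by (auto simp: z radial_test_def radial_ext_def)
  qed
  have W0: "W z = 0" if "z \<notin> cball 0 (exp R) \<times> {a..b}" for z
  proof -
    have "radial_test (\<lambda>s. L s * w s) \<theta> z = 0" "radial_test (\<lambda>s. A s * w s) (deriv \<theta>) z = 0"
      by (rule supp[OF that]; simp add: A(2) L0 \<theta>(2) \<theta>10)+
    then show ?thesis by (simp add: W_def)
  qed
  have Wint: "integrable lborel W"
  proof -
    have "smooth (radial_test (\<lambda>s. L s * w s) \<theta> :: 'a \<times> real \<Rightarrow> real)"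
      by (rule smooth_radial_test[OF Lw \<theta>(1), of "-R"]) (simp add: L0)
    moreover have "smooth (radial_test (\<lambda>s. A s * w s) (deriv \<theta>) :: 'a \<times> real \<Rightarrow> real)"
      by (rule smooth_radial_test[OF Aw \<theta>1, of "-R"]) (simp add: A(2))
    ultimately have "Ck 0 W"
      unfolding W_def[abs_def] smooth_def by (intro Ck_add) blast+
    then have "integrable lborel (\<lambda>z. indicator (cball 0 (exp R) \<times> {a..b}) z *\<^sub>R W z)"
      by (intro borel_integrable_compact compact_Times compact_cball)
         (auto intro: continuous_on_subset)
    moreover have "(\<lambda>z. indicator (cball 0 (exp R) \<times> {a..b}) z *\<^sub>R W z) = W"
    proof
      fix z show "indicator (cball 0 (exp R) \<times> {a..b}) z *\<^sub>R W z = W z"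
        by (cases "z \<in> cball 0 (exp R) \<times> {a..b}") (simp_all only: W0 indicator_simps scaleR_one scaleR_zero_right not_False_eq_True)
    qed
    ultimately show ?thesis by simp
  qed
  have W_eq: "W (x, t) = (\<theta> t * L (ln (norm x)) + deriv \<theta> t * A (ln (norm x))) / (norm x)\<^sup>2" for x :: 'a and t
    using exp_minus_2_ln[of "norm x"]
    by (auto simp: W_def radial_test_def radial_ext_def w_def add_divide_distrib mult.commute)
  let ?\<phi> = "radial_test A \<theta> :: 'a \<times> real \<Rightarrow> real"
  have weight: "laplacian ?\<phi> (x, t) + time_deriv ?\<phi> (x, t) / (norm x)\<^sup>2 = W (x, t)" for x :: 'a and t
    using laplacian_radial_test[OF A(1) \<theta>(1), of "-R" "(x, t)"] time_deriv_radial_test[OF A(1) \<theta>(1), of "-R" "(x, t)"] A(2)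
      exp_minus_2_ln[of "norm x"]
    by (auto simp: W_def L_def[abs_def] w_def radial_test_def radial_ext_def)
  obtain CA CL where C: "\<And>s. \<bar>A s\<bar> \<le> CA" "\<And>s. \<bar>L s\<bar> \<le> CL"
    using smooth_real_bounded[OF A] smooth_real_bounded[OF L L0] by metis
  \<comment> \<open>the support of \<open>\<theta>\<close> starts at \<open>a > 0\<close>, so the bound on times later than \<open>a/2\<close> covers it\<close>
  obtain v K where v: "v \<in> borel_measurable borel" "\<And>z. \<bar>v z\<bar> \<le> K"
    "AE z in lborel. z \<in> UNIV \<times> {a/2<..} \<longrightarrow> v z = (case z of (x, t) \<Rightarrow> u x t)"
  proof (rule in_Linfty_borel_representative[of "UNIV \<times> {a/2<..}" "\<lambda>(x, t). u x t"])
    show "in_Linfty (lebesgue_on (UNIV \<times> {a/2<..})) (\<lambda>(x, t). u x t)"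
      using u \<open>0 < a\<close> by (simp add: weak_solution_def)
    show "UNIV \<times> {a/2<..} \<in> sets (borel :: ('a \<times> real) measure)"
      by (intro borel_open open_Times) auto
  qed blast
  have vW: "(\<lambda>z. v z * W z) \<in> borel_measurable lborel"
    using v(1) borel_measurable_integrable[OF Wint] by simp
  have vWint: "integrable lborel (\<lambda>z. v z * W z)"
    using integrable_mult_bounded[OF Wint, of v K] v(1,2) by (simp add: mult.commute)
  have cp: "(\<lambda>(x, t). v (x, t) * W (x, t)) = (\<lambda>z. v z * W z)"
    by (auto simp: fun_eq_iff)
  have eq: "AE z in lborel. indicator Q z *\<^sub>R (case z of (x, t) \<Rightarrow> u x t * W (x, t)) = v z * W z"
    using v(3)
  proof eventually_elim
    case (elim z)
    obtain x t where z: "z = (x, t)" by fastforce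
    show ?case
    proof (cases "t \<ge> a")
      case True
      then show ?thesis using elim \<open>0 < a\<close> by (auto simp: z Q_def)
    next
      case False
      then have "W z = 0" by (intro W0) (auto simp: z)
      then show ?thesis by (simp add: z)
    qed
  qed
  have "test_function Q ?\<phi>"
    by (rule test_function_radial_test[OF A(1) \<theta>(1) A(2) \<theta>(2) \<open>0 < a\<close>])
  then have "(LINT (x, t):Q|lebesgue. u x t * (laplacian ?\<phi> (x, t) + time_deriv ?\<phi> (x, t) / (norm x)\<^sup>2)) = 0"
    using u unfolding weak_solution_def by blast
  then have "0 = (LINT z|lebesgue. indicator Q z *\<^sub>R (case z of (x, t) \<Rightarrow> u x t * W (x, t)))"
    unfolding weight set_lebesgue_integral_def by (rule sym)
  also have "\<dots> = (LINT z|lebesgue. v z * W z)"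
  proof (rule integral_cong_AE)
    show *: "(\<lambda>z. v z * W z) \<in> borel_measurable lebesgue"
      using vW by (rule measurable_completion)
    show "AE z in lebesgue. indicator Q z *\<^sub>R (case z of (x, t) \<Rightarrow> u x t * W (x, t)) = v z * W z"
      using eq by (simp only: AE_completion_iff)
    then show "(\<lambda>z. indicator Q z *\<^sub>R (case z of (x, t) \<Rightarrow> u x t * W (x, t))) \<in> borel_measurable lebesgue"
      by (intro borel_measurable_AE[OF *]) (auto elim!: eventually_mono)
  qed
  also have "\<dots> = (LINT z|lborel. v z * W z)"
    by (rule integral_completion[OF vW])
  also have "\<dots> = (LINT t|lborel. LINT x|lborel. v (x, t) * W (x, t))"
    by (rule lborel_pair.integral_snd[of "\<lambda>x t. v (x, t) * W (x, t)", unfolded lborel_prod cp, OF vWint, symmetric])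
  also have "\<dots> = (LINT t|lborel. deriv \<theta> t * log_moment (\<lambda>x. u x t) A + \<theta> t * log_moment (\<lambda>x. u x t) L)"
  proof (rule Bochner_Integration.integral_cong_AE)
    show m1: "(\<lambda>t. LINT x|lborel. v (x, t) * W (x, t)) \<in> borel_measurable lborel"
      by (rule borel_measurable_integrable)
        (rule lborel_pair.integrable_snd[of "\<lambda>x t. v (x, t) * W (x, t)", unfolded lborel_prod cp, OF vWint])
    have slice: "(LINT x|lborel. v (x, t) * W (x, t)) = deriv \<theta> t * log_moment (\<lambda>x. u x t) A + \<theta> t * log_moment (\<lambda>x. u x t) L"
      if ae: "AE x in lborel. (x, t) \<in> UNIV \<times> {a/2<..} \<longrightarrow> v (x, t) = (case (x, t) of (x, t) \<Rightarrow> u x t)" for t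
    proof (cases "t \<ge> a")
      case False
      then have "W (x, t) = 0" for x by (intro W0) auto
      then show ?thesis using False by (simp add: \<theta>(2) \<theta>10)
    next
      case True
      have u12: "in_L12 (\<lambda>x. u x t)"
        using u True \<open>0 < a\<close> by (simp add: weak_solution_def continuous_in_L12_def)
      note intA = in_L12_log_integrable[OF u12 smooth_borel_measurable[OF A(1)] C(1)]
      note intL = in_L12_log_integrable[OF u12 smooth_borel_measurable[OF L] C(2)]
      have uW: "u x t * W (x, t) = deriv \<theta> t * (u x t * A (ln (norm x)) / (norm x)\<^sup>2) +
          \<theta> t * (u x t * L (ln (norm x)) / (norm x)\<^sup>2)" for x
        unfolding W_eq by (simp add: add_divide_distrib algebra_simps)
      have int: "integrable lebesgue (\<lambda>x. u x t * W (x, t))"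
        unfolding uW by (intro Bochner_Integration.integrable_add integrable_mult_right intA intL)
      have vm: "(\<lambda>x. v (x, t) * W (x, t)) \<in> borel_measurable lborel"
        using vW by (auto intro: measurable_compose[of "\<lambda>x. (x, t)" _ _ "\<lambda>z. v z * W z"])
      have "(LINT x|lborel. v (x, t) * W (x, t)) = (LINT x|lebesgue. v (x, t) * W (x, t))"
        by (rule integral_completion[OF vm, symmetric])
      also have "\<dots> = (LINT x|lebesgue. u x t * W (x, t))"
      proof (rule Bochner_Integration.integral_cong_AE)
        show "(\<lambda>x. v (x, t) * W (x, t)) \<in> borel_measurable lebesgue"
          using vm by (rule measurable_completion)
        show "AE x in lebesgue. v (x, t) * W (x, t) = u x t * W (x, t)"
          unfolding AE_completion_iff using ae by eventually_elim (use True \<open>0 < a\<close> in auto)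
      qed (rule borel_measurable_integrable[OF int])
      also have "\<dots> = deriv \<theta> t * log_moment (\<lambda>x. u x t) A + \<theta> t * log_moment (\<lambda>x. u x t) L"
        unfolding uW log_moment_def
        by (subst Bochner_Integration.integral_add[OF integrable_mult_right[OF intA] integrable_mult_right[OF intL]])
           (simp only: integral_mult_right_zero)
      finally show ?thesis .
    qed
    show ae: "AE t in lborel. (LINT x|lborel. v (x, t) * W (x, t)) =
        deriv \<theta> t * log_moment (\<lambda>x. u x t) A + \<theta> t * log_moment (\<lambda>x. u x t) L"
      using AE_lborel_slices[OF v(3)] by eventually_elim (rule slice)
    show "(\<lambda>t. deriv \<theta> t * log_moment (\<lambda>x. u x t) A + \<theta> t * log_moment (\<lambda>x. u x t) L) \<in> borel_measurable lborel"
      (is "?g \<in> _")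
    proof -
      have cu: "continuous_in_L12 u" using u by (simp add: weak_solution_def)
      have "Ck 0 \<theta>" "Ck 0 (deriv \<theta>)" using \<theta>(1) \<theta>1 unfolding smooth_def by blast+
      then have "continuous_on {0..} ?g"
        by (intro continuous_intros continuous_on_log_moment[OF cu smooth_borel_measurable[OF A(1)] C(1)]
            continuous_on_log_moment[OF cu smooth_borel_measurable[OF L] C(2)]) (auto intro: continuous_on_subset)
      then have "(\<lambda>t. indicator {0..} t *\<^sub>R ?g t) \<in> borel_measurable borel"
        by (intro borel_measurable_continuous_on_indicator) auto
      moreover have "(\<lambda>t. indicator {0..} t *\<^sub>R ?g t) = ?g"
        using \<open>0 < a\<close> \<theta>(2) \<theta>10 by (auto simp: fun_eq_iff indicator_def)
      ultimately show ?thesis by simp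
    qed
  qed
  finally show ?thesis by (simp add: L_def[abs_def])
qed

text \<open>
  Smoothed indicators of the interval are admissible; when the smoothing width tends to 0, their derivatives
  concentrate at the two end points and the functions themselves converge to the indicator.
\<close>

lemma weak_derivative_imp_integral:
  fixes f g :: "real \<Rightarrow> real"
  assumes cont: "continuous_on {0<..} f" "continuous_on {0<..} g"
    and weak: "\<And>\<theta> a' b'. smooth \<theta> \<Longrightarrow> 0 < a' \<Longrightarrow> (\<And>t. t \<notin> {a'..b'} \<Longrightarrow> \<theta> t = 0) \<Longrightarrow>
       (LINT t|lborel. deriv \<theta> t * f t + \<theta> t * g t) = 0"
    and "0 < a" "a < b"
  shows "f b - f a = integral {a..b} g"
proof -
  define S where "S = {a/2..b+a/2}"
  define \<delta> where "\<delta> n = a / 2 / real (Suc n)" for n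
  \<comment> \<open>a smoothed indicator of the interval from \<open>a\<close> to \<open>b\<close>; the transition width \<open>\<delta> n\<close> is at most
    \<open>a/2\<close>, which keeps its support \<open>S\<close> away from time 0\<close>
  define \<theta> where "\<theta> n t = smooth_step ((t - a) / \<delta> n) - smooth_step ((t - b) / \<delta> n)" for n t
  define \<theta>' where "\<theta>' n t = deriv smooth_step ((t - a) / \<delta> n) / \<delta> n - deriv smooth_step ((t - b) / \<delta> n) / \<delta> n" for n t
  \<comment> \<open>truncated to \<open>S\<close>, both functions become bounded and Borel on the whole line\<close>
  define F where "F t = indicator S t *\<^sub>R f t" for t
  define H where "H t = indicator S t *\<^sub>R g t" for t
  have \<delta>: "\<delta> n > 0" "\<delta> n \<le> a / 2" for n
    using \<open>0 < a\<close> by (auto simp: \<delta>_def field_simps)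
  have \<delta>0: "\<delta> \<longlonglongrightarrow> 0"
    unfolding \<delta>_def by real_asymp
  have S: "compact S" "S \<subseteq> {0<..}" "S \<in> sets borel"
    using \<open>0 < a\<close> by (auto simp: S_def)
  have bdd: "(\<exists>B. \<forall>t. \<bar>indicator S t *\<^sub>R h t\<bar> \<le> B) \<and> (\<lambda>t. indicator S t *\<^sub>R h t) \<in> borel_measurable borel"
    if "continuous_on {0<..} h" for h :: "real \<Rightarrow> real"
  proof
    have c: "continuous_on S h" using that S(2) continuous_on_subset by blast
    then obtain B where "\<And>t. t \<in> S \<Longrightarrow> norm (h t) \<le> B"
      by (metis S(1) bounded_iff compact_continuous_image compact_imp_bounded imageI)
    then have "\<bar>indicator S t *\<^sub>R h t\<bar> \<le> \<bar>B\<bar>" for t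
      by (cases "t \<in> S") force+
    then show "\<exists>B. \<forall>t. \<bar>indicator S t *\<^sub>R h t\<bar> \<le> B" by blast
    show "(\<lambda>t. indicator S t *\<^sub>R h t) \<in> borel_measurable borel"
      by (rule borel_measurable_continuous_on_indicator[OF S(3) c])
  qed
  obtain BF BH where F: "F \<in> borel_measurable borel" "\<And>t. \<bar>F t\<bar> \<le> BF"
    and H: "H \<in> borel_measurable borel" "\<And>t. \<bar>H t\<bar> \<le> BH"
    using bdd[OF cont(1)] bdd[OF cont(2)] unfolding F_def[abs_def] H_def[abs_def] by blast
  have isCont: "isCont F p" if "p \<in> {a, b}" for p
  proof -
    have "isCont f p" using cont(1) that \<open>0 < a\<close> \<open>a < b\<close>
      by (auto simp: continuous_on_eq_continuous_at)
    moreover have "\<forall>\<^sub>F t in nhds p. t \<in> {a/2<..<b+a/2}"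
      by (rule eventually_nhds_in_open) (use that \<open>0 < a\<close> \<open>a < b\<close> in auto)
    then have "\<forall>\<^sub>F t in nhds p. F t = f t"
      by eventually_elim (auto simp: F_def S_def)
    ultimately show ?thesis using isCont_cong by blast
  qed
  have \<theta>_eq: "\<theta> n = (\<lambda>t. smooth_step (1 / \<delta> n * t + - a / \<delta> n) - smooth_step (1 / \<delta> n * t + - b / \<delta> n))" for n
    by (simp add: \<theta>_def[abs_def] diff_divide_distrib)
  have \<theta>: "smooth (\<theta> n)" for n
    unfolding \<theta>_eq smooth_def
    by (intro allI Ck_diff smooth_affine_smooth_step[unfolded smooth_def, rule_format])
  have d\<theta>: "deriv (\<theta> n) = \<theta>' n" for n
  proof
    fix t
    show "deriv (\<theta> n) t = \<theta>' n t"
      unfolding \<theta>_eq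
      by (rule DERIV_imp_deriv, rule DERIV_cong[OF DERIV_diff[OF smooth_step_affine_deriv smooth_step_affine_deriv]])
         (simp add: \<theta>'_def diff_divide_distrib)
  qed
  have \<theta>0: "\<theta> n t = 0" if tS: "t \<notin> S" for n t
  proof -
    consider "t < a - \<delta> n" | "t > b + \<delta> n"
      using tS \<delta>(2)[of n] unfolding S_def atLeastAtMost_iff by linarith
    then show ?thesis
    proof cases
      case 1
      then have "(t - a) / \<delta> n \<le> -1" "(t - b) / \<delta> n \<le> -1"
        using \<delta>(1)[of n] \<open>a < b\<close> by (auto simp: field_simps)
      then show ?thesis by (simp add: \<theta>_def smooth_step_0)
    next
      case 2
      then have "(t - a) / \<delta> n \<ge> 1" "(t - b) / \<delta> n \<ge> 1"
        using \<delta>(1)[of n] \<open>a < b\<close> by (auto simp: field_simps)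
      then show ?thesis by (simp add: \<theta>_def smooth_step_1)
    qed
  qed
  have \<theta>'0: "\<theta>' n t = 0" if "t \<notin> S" for n t
    unfolding d\<theta>[symmetric]
    by (rule deriv_zero_on_open[OF \<theta>, of "- S"]) (use that \<theta>0 S in \<open>auto simp: compact_imp_closed open_Compl\<close>)
  have \<theta>_int: "integrable lborel (\<theta> n)" for n
  proof -
    have "integrable lborel (\<lambda>t. indicator S t *\<^sub>R \<theta> n t)"
      by (intro borel_integrable_compact smooth_continuous \<theta> S)
    moreover have "(\<lambda>t. indicator S t *\<^sub>R \<theta> n t) = \<theta> n"
      using \<theta>0 by (auto simp: fun_eq_iff indicator_def)
    ultimately show ?thesis by simp
  qed
  have K_int: "integrable lborel (\<lambda>t. deriv smooth_step ((t - p) / \<delta> n) / \<delta> n * F t)" for p n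
  proof (rule integrable_mult_bounded[OF _ _ F(2)])
    have "integrable lborel (\<lambda>t. deriv smooth_step (- p / \<delta> n + 1 / \<delta> n * t))"
      by (rule lborel_integrable_real_affine[OF integrable_smooth_step_deriv]) (use \<delta>(1)[of n] in simp)
    moreover have "(\<lambda>t. deriv smooth_step (- p / \<delta> n + 1 / \<delta> n * t)) = (\<lambda>t. deriv smooth_step ((t - p) / \<delta> n))"
      by (simp add: diff_divide_distrib)
    ultimately show "integrable lborel (\<lambda>t. deriv smooth_step ((t - p) / \<delta> n) / \<delta> n)"
      by simp
  qed (use F(1) in simp)
  have zero: "(LINT t|lborel. deriv smooth_step ((t - a) / \<delta> n) / \<delta> n * F t) -
      (LINT t|lborel. deriv smooth_step ((t - b) / \<delta> n) / \<delta> n * F t) + (LINT t|lborel. \<theta> n t * H t) = 0" for n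
  proof -
    have "0 = (LINT t|lborel. \<theta>' n t * f t + \<theta> n t * g t)"
      using weak[OF \<theta>[of n], of "a/2" "b+a/2"] \<theta>0 \<open>0 < a\<close> by (simp add: S_def d\<theta>)
    also have "(\<lambda>t. \<theta>' n t * f t + \<theta> n t * g t) =
      (\<lambda>t. deriv smooth_step ((t - a) / \<delta> n) / \<delta> n * F t -
           deriv smooth_step ((t - b) / \<delta> n) / \<delta> n * F t + \<theta> n t * H t)"
    proof
      fix t show "\<theta>' n t * f t + \<theta> n t * g t = deriv smooth_step ((t - a) / \<delta> n) / \<delta> n * F t -
           deriv smooth_step ((t - b) / \<delta> n) / \<delta> n * F t + \<theta> n t * H t"
        using \<theta>0[of t n] \<theta>'0[of t n]
        by (cases "t \<in> S") (auto simp: F_def H_def \<theta>'_def left_diff_distrib)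
    qed
    also have "(LINT t|lborel. deriv smooth_step ((t - a) / \<delta> n) / \<delta> n * F t -
           deriv smooth_step ((t - b) / \<delta> n) / \<delta> n * F t + \<theta> n t * H t) =
      (LINT t|lborel. deriv smooth_step ((t - a) / \<delta> n) / \<delta> n * F t) -
      (LINT t|lborel. deriv smooth_step ((t - b) / \<delta> n) / \<delta> n * F t) + (LINT t|lborel. \<theta> n t * H t)"
      by (subst Bochner_Integration.integral_add[OF Bochner_Integration.integrable_diff[OF K_int K_int] integrable_mult_bounded[OF \<theta>_int _ H(2)]])
         (use H(1) Bochner_Integration.integral_diff[OF K_int K_int] in simp_all)
    finally show ?thesis by simp
  qed
  have lim: "(\<lambda>n. LINT t|lborel. \<theta> n t * H t) \<longlonglongrightarrow> (LINT t|lborel. indicator {a..b} t *\<^sub>R g t)"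
  proof (rule integral_dominated_convergence[where w = "\<lambda>t. indicator S t *\<^sub>R (1 * BH)"])
    have "integrable lborel (\<lambda>t. indicator {a..b} t *\<^sub>R g t)"
      by (intro borel_integrable_compact continuous_on_subset[OF cont(2)]) (use \<open>0 < a\<close> in auto)
    then show "(\<lambda>t. indicator {a..b} t *\<^sub>R g t) \<in> borel_measurable lborel" by simp
    show "(\<lambda>t. \<theta> n t * H t) \<in> borel_measurable lborel" for n
      using H(1) borel_measurable_integrable[OF \<theta>_int[of n]] by simp
    show "integrable lborel (\<lambda>t. indicator S t *\<^sub>R (1 * BH))"
      by (rule borel_integrable_compact[OF S(1)]) simp
    show "AE t in lborel. norm (\<theta> n t * H t) \<le> indicator S t *\<^sub>R (1 * BH)" for n
    proof (rule AE_I2)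
      fix t
      have "\<bar>\<theta> n t\<bar> \<le> 1"
        using smooth_step_range[of "(t - a) / \<delta> n"] smooth_step_range[of "(t - b) / \<delta> n"] by (simp add: \<theta>_def)
      then have "\<bar>\<theta> n t\<bar> * \<bar>H t\<bar> \<le> 1 * BH"
        by (intro mult_mono H(2)) auto
      then show "norm (\<theta> n t * H t) \<le> indicator S t *\<^sub>R (1 * BH)"
        using \<theta>0[of t n] by (cases "t \<in> S") (auto simp: abs_mult)
    qed
    have "AE t in lborel. t \<noteq> a \<and> t \<noteq> b"
      using AE_lborel_singleton[of a] AE_lborel_singleton[of b] by eventually_elim auto
    then show "AE t in lborel. (\<lambda>n. \<theta> n t * H t) \<longlonglongrightarrow> indicator {a..b} t *\<^sub>R g t"
    proof eventually_elim
      case (elim t)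
      have "(\<lambda>n. \<theta> n t * H t) \<longlonglongrightarrow> (indicator {a<..} t - indicator {b<..} t) * H t"
        unfolding \<theta>_def by (intro tendsto_intros smooth_step_scaled_tendsto \<delta> \<delta>0) (use elim in auto)
      also have "(indicator {a<..} t - indicator {b<..} t) * H t = indicator {a..b} t *\<^sub>R g t"
        using elim \<open>a < b\<close> \<open>0 < a\<close> by (auto simp: indicator_def H_def S_def)
      finally show ?case .
    qed
  qed
  have "(\<lambda>n. (LINT t|lborel. deriv smooth_step ((t - a) / \<delta> n) / \<delta> n * F t) -
      (LINT t|lborel. deriv smooth_step ((t - b) / \<delta> n) / \<delta> n * F t) + (LINT t|lborel. \<theta> n t * H t))
      \<longlonglongrightarrow> F a - F b + (LINT t|lborel. indicator {a..b} t *\<^sub>R g t)"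
    by (intro tendsto_intros lim smooth_step_concentrates[OF F] isCont \<delta> \<delta>0) auto
  then have "F a - F b + (LINT t|lborel. indicator {a..b} t *\<^sub>R g t) = 0"
    unfolding zero by (simp add: LIMSEQ_const_iff)
  moreover have "(LINT t|lborel. indicator {a..b} t *\<^sub>R g t) = integral {a..b} g"
  proof -
    have "{a..b} \<subseteq> {0<..}" using \<open>0 < a\<close> by auto
    then have "integrable lborel (\<lambda>t. indicator {a..b} t *\<^sub>R g t)"
      by (intro borel_integrable_compact continuous_on_subset[OF cont(2)]) auto
    then show ?thesis
      using set_borel_integral_eq_integral(2)[of "{a..b}" g]
      unfolding set_integrable_def set_lebesgue_integral_def by blast
  qed
  moreover have "F a = f a" "F b = f b"
    using \<open>0 < a\<close> \<open>a < b\<close> by (auto simp: F_def S_def)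
  ultimately show ?thesis by simp
qed


section \<open>The Fourier transform of a solution\<close>

text \<open>
  A smooth plateau: 1 on the interval of half-length \<open>n\<close>, 0 outside that of half-length \<open>n + 2\<close>.
\<close>

definition cutoff :: "nat \<Rightarrow> real \<Rightarrow> real" where
  "cutoff n s = smooth_step (1 * s + (real n + 1)) - smooth_step (1 * s + (- real n - 1))"

definition cutoff' :: "nat \<Rightarrow> real \<Rightarrow> real" where
  "cutoff' n s = deriv smooth_step (s + (real n + 1)) - deriv smooth_step (s + (- real n - 1))"

definition cutoff'' :: "nat \<Rightarrow> real \<Rightarrow> real" where
  "cutoff'' n s = deriv (deriv smooth_step) (s + (real n + 1)) - deriv (deriv smooth_step) (s + (- real n - 1))"

lemma smooth_cutoff: "smooth (cutoff n)"
  unfolding smooth_def cutoff_def[abs_def]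
  by (intro allI Ck_diff smooth_affine_smooth_step[unfolded smooth_def, rule_format])

lemma cutoff_deriv: "(cutoff n has_real_derivative cutoff' n s) (at s)"
  unfolding cutoff_def[abs_def] cutoff'_def
  by (rule DERIV_cong[OF DERIV_diff[OF smooth_step_affine_deriv smooth_step_affine_deriv]]) simp

lemma cutoff'_deriv: "(cutoff' n has_real_derivative cutoff'' n s) (at s)"
proof -
  have "((\<lambda>s. deriv smooth_step (s + c)) has_real_derivative deriv (deriv smooth_step) (s + c) * 1) (at s)" for c s
    by (rule DERIV_chain2[OF smooth_real_has_deriv[OF smooth_real_deriv[OF smooth_smooth_step]]])
       (auto intro!: derivative_eq_intros)
  from DERIV_diff[OF this[of "real n + 1" s] this[of "- real n - 1" s]]
  show ?thesis unfolding cutoff'_def[abs_def] cutoff''_def by simp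
qed

lemma cutoff_0: "\<bar>s\<bar> > real n + 2 \<Longrightarrow> cutoff n s = 0"
proof (cases "s > 0")
  case True
  moreover assume "\<bar>s\<bar> > real n + 2"
  ultimately have "1 * s + (real n + 1) \<ge> 1" "1 * s + (- real n - 1) \<ge> 1" by linarith+
  then show ?thesis by (simp add: cutoff_def smooth_step_1)
next
  case False
  moreover assume "\<bar>s\<bar> > real n + 2"
  ultimately have "1 * s + (real n + 1) \<le> -1" "1 * s + (- real n - 1) \<le> -1" by linarith+
  then show ?thesis by (simp add: cutoff_def smooth_step_0)
qed

text \<open>
  Since the flanks move to infinity, at each fixed point the cutoff is eventually constant.
\<close>

lemma cutoff_eventually:
  "\<forall>\<^sub>F n in sequentially. cutoff n s = 1 \<and> cutoff' n s = 0 \<and> cutoff'' n s = 0"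
proof -
  obtain m :: nat where m: "\<bar>s\<bar> \<le> real m" using real_arch_simple by blast
  show ?thesis
    using eventually_gt_at_top[of m]
  proof eventually_elim
    case (elim n)
    then have "s + (real n + 1) > 1" "s + (- real n - 1) < -1" using m by linarith+
    then show ?case
      by (auto simp: cutoff_def cutoff'_def cutoff''_def smooth_step_0 smooth_step_1
          smooth_step_deriv_0 smooth_step_deriv2_0)
  qed
qed

lemma cutoff_le: "\<bar>cutoff n s\<bar> \<le> 1"
  using smooth_step_range[of "1 * s + (real n + 1)"] smooth_step_range[of "1 * s + (- real n - 1)"]
  by (simp add: cutoff_def)

lemma cutoff'_le: obtains D where "\<And>n s. \<bar>cutoff' n s\<bar> \<le> D"
proof -
  obtain C where "\<And>s. \<bar>deriv smooth_step s\<bar> \<le> C"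
    using smooth_real_bounded[OF smooth_real_deriv[OF smooth_smooth_step] smooth_step_deriv_0] by blast
  then have "\<bar>cutoff' n s\<bar> \<le> C + C" for n s
    unfolding cutoff'_def by (intro order_trans[OF abs_triangle_ineq4] add_mono)
  then show ?thesis by (rule that)
qed

lemma cutoff''_le: obtains D where "\<And>n s. \<bar>cutoff'' n s\<bar> \<le> D"
proof -
  obtain C where "\<And>s. \<bar>deriv (deriv smooth_step) s\<bar> \<le> C"
    using smooth_real_bounded[OF smooth_real_deriv[OF smooth_real_deriv[OF smooth_smooth_step]] smooth_step_deriv2_0] by blast
  then have "\<bar>cutoff'' n s\<bar> \<le> C + C" for n s
    unfolding cutoff''_def by (intro order_trans[OF abs_triangle_ineq4] add_mono)
  then show ?thesis by (rule that)
qed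

text \<open>
  The cosine is not compactly supported, but the cutoff has derivatives bounded independently of \<open>n\<close>
  that vanish eventually at each point.  As \<open>u / |x|\<^sup>2\<close> is integrable, dominated convergence removes
  the cutoff.
\<close>

lemma weak_solution_log_moment_cos:
  fixes u :: "'a::euclidean_space \<Rightarrow> real \<Rightarrow> real"
  assumes u: "weak_solution u0 u" and "0 < a" "a < b"
  shows "log_moment (\<lambda>x. u x b) (\<lambda>s. cos (\<xi> * s + d)) - log_moment (\<lambda>x. u x a) (\<lambda>s. cos (\<xi> * s + d)) =
    integral {a..b} (\<lambda>t. log_moment (\<lambda>x. u x t)
      (\<lambda>s. - \<xi>\<^sup>2 * cos (\<xi> * s + d) - (real DIM('a) - 2) * \<xi> * sin (\<xi> * s + d)))"
proof -
  have cu: "continuous_in_L12 u" using u by (simp add: weak_solution_def)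
  have u12: "in_L12 (\<lambda>x. u x t)" if "t \<ge> 0" for t using cu that by (simp add: continuous_in_L12_def)
  define N where "N = real DIM('a) - 2"
  define A where "A n s = cutoff n s * cos (\<xi> * s + d)" for n s
  define A' where "A' n s = cutoff' n s * cos (\<xi> * s + d) - \<xi> * cutoff n s * sin (\<xi> * s + d)" for n s
  \<comment> \<open>\<open>A'\<close> and \<open>A''\<close> are the first two derivatives of \<open>A n\<close>, and \<open>B\<close> is what is left of
    \<open>L n = A'' n + N * A' n\<close> when the cutoff is replaced by 1\<close>
  define A'' where "A'' n s = cutoff'' n s * cos (\<xi> * s + d) - 2 * \<xi> * cutoff' n s * sin (\<xi> * s + d)
     - \<xi>\<^sup>2 * cutoff n s * cos (\<xi> * s + d)" for n s
  define B where "B s = - \<xi>\<^sup>2 * cos (\<xi> * s + d) - N * \<xi> * sin (\<xi> * s + d)" for s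
  have A: "smooth (A n)" for n
    using smooth_cutoff[of n] unfolding A_def[abs_def] smooth_def by (intro allI Ck_mult Ck_cos) simp
  have dA: "deriv (A n) = A' n" for n
    unfolding A_def[abs_def] A'_def
    by (intro ext DERIV_imp_deriv) (auto intro!: derivative_eq_intros cutoff_deriv simp: algebra_simps)
  have dA': "deriv (A' n) = A'' n" for n
    unfolding A'_def[abs_def] A''_def
    by (intro ext DERIV_imp_deriv)
       (auto intro!: derivative_eq_intros cutoff_deriv cutoff'_deriv simp: algebra_simps power2_eq_square)
  define L where "L n s = A'' n s + N * A' n s" for n s
  have L: "smooth (L n)" for n
    using smooth_real_deriv[OF A[of n]] smooth_real_deriv[OF smooth_real_deriv[OF A[of n]]]
    unfolding L_def[abs_def] dA dA' smooth_def by (intro allI Ck_add Ck_mult Ck_const) simp_all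
  obtain D1 D2 where D: "\<And>n s. \<bar>cutoff' n s\<bar> \<le> D1" "\<And>n s. \<bar>cutoff'' n s\<bar> \<le> D2"
    using cutoff'_le cutoff''_le by metis
  have A1: "\<bar>A n s\<bar> \<le> 1" for n s
    using mult_mono[OF cutoff_le[of n s] abs_cos_le_one[of "\<xi> * s + d"]] by (simp add: A_def abs_mult)
  define C where "C = D2 + 2 * \<bar>\<xi>\<bar> * D1 + \<xi>\<^sup>2 + \<bar>N\<bar> * (D1 + \<bar>\<xi>\<bar>)"
  have LC: "\<bar>L n s\<bar> \<le> C" for n s
  proof -
    have prod: "\<bar>c * x * y\<bar> \<le> \<bar>c\<bar> * K" if "\<bar>x\<bar> \<le> K" "\<bar>y\<bar> \<le> 1" for c x y K :: real
    proof -
      have "\<bar>x\<bar> * \<bar>y\<bar> \<le> K * 1" using that by (intro mult_mono) auto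
      then show ?thesis by (simp add: abs_mult mult.assoc mult_left_mono)
    qed
    have 1: "\<bar>cutoff'' n s * cos (\<xi> * s + d)\<bar> \<le> D2" "\<bar>cutoff' n s * cos (\<xi> * s + d)\<bar> \<le> D1"
      using prod[OF D(2)[of n s] abs_cos_le_one[of "\<xi> * s + d"], of 1]
        prod[OF D(1)[of n s] abs_cos_le_one[of "\<xi> * s + d"], of 1] by simp_all
    have 2: "\<bar>2 * \<xi> * cutoff' n s * sin (\<xi> * s + d)\<bar> \<le> 2 * \<bar>\<xi>\<bar> * D1"
      using prod[OF D(1)[of n s] abs_sin_le_one[of "\<xi> * s + d"], of "2 * \<xi>"] by (simp add: abs_mult)
    have 3: "\<bar>\<xi>\<^sup>2 * cutoff n s * cos (\<xi> * s + d)\<bar> \<le> \<xi>\<^sup>2" "\<bar>\<xi> * cutoff n s * sin (\<xi> * s + d)\<bar> \<le> \<bar>\<xi>\<bar>"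
      using prod[OF cutoff_le[of n s] abs_cos_le_one[of "\<xi> * s + d"], of "\<xi>\<^sup>2"]
        prod[OF cutoff_le[of n s] abs_sin_le_one[of "\<xi> * s + d"], of "\<xi>"] by simp_all
    have "\<bar>A'' n s\<bar> \<le> D2 + 2 * \<bar>\<xi>\<bar> * D1 + \<xi>\<^sup>2" "\<bar>A' n s\<bar> \<le> D1 + \<bar>\<xi>\<bar>"
      using 1 2 3 unfolding A''_def A'_def by linarith+
    moreover from this(2) have "\<bar>N * A' n s\<bar> \<le> \<bar>N\<bar> * (D1 + \<bar>\<xi>\<bar>)"
      by (simp add: abs_mult mult_left_mono)
    ultimately show ?thesis unfolding L_def C_def by linarith
  qed
  have Alim: "(\<lambda>n. A n s) \<longlonglongrightarrow> cos (\<xi> * s + d)" for s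
    by (rule tendsto_eventually, rule eventually_mono[OF cutoff_eventually[of s]]) (simp add: A_def)
  have Llim: "(\<lambda>n. L n s) \<longlonglongrightarrow> B s" for s
    by (rule tendsto_eventually, rule eventually_mono[OF cutoff_eventually[of s]])
       (simp add: L_def A'_def A''_def B_def algebra_simps)
  have Bm: "B \<in> borel_measurable borel"
    unfolding B_def by measurable
  let ?P = "\<lambda>k t. log_moment (\<lambda>x. u x t) k"
  have eq: "?P (A n) b - ?P (A n) a = integral {a..b} (?P (L n))" for n
  proof (rule weak_derivative_imp_integral[OF _ _ _ assms(2,3)])
    show "continuous_on {0<..} (?P (A n))"
      by (rule continuous_on_subset[OF continuous_on_log_moment[OF cu smooth_borel_measurable[OF A] A1]]) auto
    show "continuous_on {0<..} (?P (L n))"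
      by (rule continuous_on_subset[OF continuous_on_log_moment[OF cu smooth_borel_measurable[OF L] LC]]) auto
    show "(LINT t|lborel. deriv \<theta> t * ?P (A n) t + \<theta> t * ?P (L n) t) = 0"
      if "smooth \<theta>" "0 < a'" "\<And>t. t \<notin> {a'..b'} \<Longrightarrow> \<theta> t = 0" for \<theta> a' b'
      using weak_solution_radial_test[OF u A[of n] _ that(1,3,2), of "real n + 2"]
      by (simp add: A_def cutoff_0 dA dA' L_def[abs_def] N_def)
  qed
  \<comment> \<open>the total mass bounds all the moments, uniformly for times in the compact interval\<close>
  have P1: "continuous_on {0..} (?P (\<lambda>s. 1))"
    by (rule continuous_on_log_moment[OF cu, where C = 1]) auto
  have "compact (?P (\<lambda>s. 1) ` {a..b})"
    by (rule compact_continuous_image[OF continuous_on_subset[OF P1]]) (use \<open>0 < a\<close> in auto)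
  from compact_imp_bounded[OF this, unfolded bounded_iff]
  obtain E where E: "\<And>t. t \<in> {a..b} \<Longrightarrow> norm (?P (\<lambda>s. 1) t) \<le> E"
    by blast
  have C0: "0 \<le> C" using LC[of 0 0] by linarith
  have PL: "norm (?P (L n) t) \<le> C * E" if "t \<in> {a..b}" for n t
  proof -
    have t: "t \<ge> 0" using that \<open>0 < a\<close> by simp
    have "\<bar>?P (L n) t\<bar> \<le> C * L12_norm (\<lambda>x. u x t)"
      by (rule log_moment_abs_le[OF u12[OF t] smooth_borel_measurable[OF L] LC])
    also have "L12_norm (\<lambda>x. u x t) = ?P (\<lambda>s. 1) t"
      unfolding L12_norm_def log_moment_def
    proof (rule integral_cong_AE)
      show "(\<lambda>x. \<bar>u x t\<bar> / (norm x)\<^sup>2) \<in> borel_measurable lebesgue"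
        using u12[OF t] by (auto simp: in_L12_def)
      show "(\<lambda>x. u x t * 1 / (norm x)\<^sup>2) \<in> borel_measurable lebesgue"
        by (rule borel_measurable_integrable[OF in_L12_log_integrable[OF u12[OF t], where C = 1]]) auto
      have "AE x in lebesgue. u x t \<ge> 0" using u t by (simp add: weak_solution_def)
      then show "AE x in lebesgue. \<bar>u x t\<bar> / (norm x)\<^sup>2 = u x t * 1 / (norm x)\<^sup>2"
        by eventually_elim simp
    qed
    also have "C * ?P (\<lambda>s. 1) t \<le> C * E"
      using E[OF that] C0 by (intro mult_left_mono) auto
    finally show ?thesis by simp
  qed
  have "(\<lambda>n. integral {a..b} (?P (L n))) \<longlonglongrightarrow> integral {a..b} (?P B)"
  proof (rule dominated_convergence(2))
    show "?P (L n) integrable_on {a..b}" for n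
      by (rule integrable_continuous_real, rule continuous_on_subset[OF continuous_on_log_moment[OF cu smooth_borel_measurable[OF L] LC]])
         (use \<open>0 < a\<close> in auto)
    show "(\<lambda>t. C * E) integrable_on {a..b}" by (rule integrable_const_ivl)
    show "(\<lambda>n. ?P (L n) t) \<longlonglongrightarrow> ?P B t" if "t \<in> {a..b}" for t
      by (rule log_moment_tendsto[OF u12 smooth_borel_measurable[OF L] LC Bm Llim]) (use that \<open>0 < a\<close> in auto)
  qed (rule PL)
  moreover have "(\<lambda>n. ?P (A n) b - ?P (A n) a) \<longlonglongrightarrow> ?P (\<lambda>s. cos (\<xi> * s + d)) b - ?P (\<lambda>s. cos (\<xi> * s + d)) a"
    by (intro tendsto_diff log_moment_tendsto[OF u12 smooth_borel_measurable[OF A] A1 _ Alim]) (use assms(2,3) in auto)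
  ultimately have "?P (\<lambda>s. cos (\<xi> * s + d)) b - ?P (\<lambda>s. cos (\<xi> * s + d)) a = integral {a..b} (?P B)"
    unfolding eq by (rule LIMSEQ_unique[rotated])
  then show ?thesis by (simp add: B_def[abs_def] N_def)
qed

lemma constant_if_deriv_zero_interior:
  fixes p :: "real \<Rightarrow> real"
  assumes "continuous_on {0..} p" "\<And>t. t > 0 \<Longrightarrow> (p has_real_derivative 0) (at t)" "t \<ge> 0"
  shows "p t = p 0"
proof (cases "t = 0")
  case False
  then have "0 < t" using assms(3) by simp
  then show ?thesis
    by (rule DERIV_isconst_end) (use assms in \<open>auto intro: continuous_on_subset\<close>)
qed simp

text \<open>
  The cosine and sine moments satisfy the linear system with matrix rows \<open>(- \<xi>\<^sup>2, - N \<xi>)\<close> and \<open>(N \<xi>, - \<xi>\<^sup>2)\<close>,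
  which is the equation \<open>c' = (- \<xi>\<^sup>2 + i N \<xi>) c\<close> for the Fourier transform \<open>c\<close>.
\<close>

lemma weak_solution_fourier:
  fixes u :: "'a::euclidean_space \<Rightarrow> real \<Rightarrow> real"
  assumes u: "weak_solution u0 u" and "t \<ge> 0"
  defines "N \<equiv> real DIM('a) - 2"
  shows "log_moment (\<lambda>x. u x t) (\<lambda>s. cos (\<xi> * s)) = exp (- \<xi>\<^sup>2 * t) *
      (cos (N * \<xi> * t) * log_moment (\<lambda>x. u x 0) (\<lambda>s. cos (\<xi> * s)) - sin (N * \<xi> * t) * log_moment (\<lambda>x. u x 0) (\<lambda>s. sin (\<xi> * s)))"
    and "log_moment (\<lambda>x. u x t) (\<lambda>s. sin (\<xi> * s)) = exp (- \<xi>\<^sup>2 * t) *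
      (sin (N * \<xi> * t) * log_moment (\<lambda>x. u x 0) (\<lambda>s. cos (\<xi> * s)) + cos (N * \<xi> * t) * log_moment (\<lambda>x. u x 0) (\<lambda>s. sin (\<xi> * s)))"
proof -
  have cu: "continuous_in_L12 u" using u by (simp add: weak_solution_def)
  have u12: "in_L12 (\<lambda>x. u x t)" if "t \<ge> 0" for t using cu that by (simp add: continuous_in_L12_def)
  define X where "X t = log_moment (\<lambda>x. u x t) (\<lambda>s. cos (\<xi> * s))" for t
  define Y where "Y t = log_moment (\<lambda>x. u x t) (\<lambda>s. sin (\<xi> * s))" for t
  have m: "(\<lambda>s. cos (\<xi> * s)) \<in> borel_measurable borel" "(\<lambda>s. sin (\<xi> * s)) \<in> borel_measurable borel"
    by measurable
  have X: "continuous_on {0..} X" and Y: "continuous_on {0..} Y"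
    unfolding X_def[abs_def] Y_def[abs_def]
    by (rule continuous_on_log_moment[OF cu m(1) abs_cos_le_one] continuous_on_log_moment[OF cu m(2) abs_sin_le_one])+
  have lin: "log_moment (\<lambda>x. u x t) (\<lambda>s. c * cos (\<xi> * s) + d * sin (\<xi> * s)) = c * X t + d * Y t"
    if "t \<ge> 0" for c d t
    unfolding X_def Y_def by (rule log_moment_linear[OF u12[OF that] m(1) abs_cos_le_one m(2) abs_sin_le_one])
  have X_int: "X b - X a = integral {a..b} (\<lambda>t. - \<xi>\<^sup>2 * X t + (- (N * \<xi>)) * Y t)" if "0 < a" "a < b" for a b
  proof -
    have "X b - X a = integral {a..b} (\<lambda>t. log_moment (\<lambda>x. u x t) (\<lambda>s. - \<xi>\<^sup>2 * cos (\<xi> * s) + (- (N * \<xi>)) * sin (\<xi> * s)))"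
      using weak_solution_log_moment_cos[OF u that, of \<xi> 0] by (simp add: X_def N_def)
    also have "\<dots> = integral {a..b} (\<lambda>t. - \<xi>\<^sup>2 * X t + (- (N * \<xi>)) * Y t)"
      by (rule Henstock_Kurzweil_Integration.integral_cong, rule lin) (use that in auto)
    finally show ?thesis .
  qed
  have Y_int: "Y b - Y a = integral {a..b} (\<lambda>t. (N * \<xi>) * X t + (- \<xi>\<^sup>2) * Y t)" if "0 < a" "a < b" for a b
  proof -
    \<comment> \<open>the phase \<open>- pi / 2\<close> turns the cosine into the sine\<close>
    have c: "cos (\<xi> * s + - (pi / 2)) = sin (\<xi> * s)" "sin (\<xi> * s + - (pi / 2)) = - cos (\<xi> * s)" for s
      by (simp_all add: cos_diff sin_diff)
    have "Y b - Y a = integral {a..b} (\<lambda>t. log_moment (\<lambda>x. u x t) (\<lambda>s. (N * \<xi>) * cos (\<xi> * s) + (- \<xi>\<^sup>2) * sin (\<xi> * s)))"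
      using weak_solution_log_moment_cos[OF u that, of \<xi> "- (pi / 2)", unfolded c]
      by (simp add: Y_def N_def algebra_simps)
    also have "\<dots> = integral {a..b} (\<lambda>t. (N * \<xi>) * X t + (- \<xi>\<^sup>2) * Y t)"
      by (rule Henstock_Kurzweil_Integration.integral_cong, rule lin) (use that in auto)
    finally show ?thesis .
  qed
  have deriv: "(f has_real_derivative g t) (at t)"
    if int: "\<And>a b. 0 < a \<Longrightarrow> a < b \<Longrightarrow> f b - f a = integral {a..b} g" and g: "continuous_on {0..} g" and t: "t > 0"
    for f g :: "real \<Rightarrow> real" and t
  proof -
    have "((\<lambda>x. integral {t/2..x} g) has_real_derivative g t) (at t within {t/2..t+1})"
      by (rule integral_has_real_derivative) (use t in \<open>auto intro: continuous_on_subset[OF g]\<close>)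
    then have "((\<lambda>x. integral {t/2..x} g) has_real_derivative g t) (at t)"
      using t by (simp add: at_within_Icc_at)
    then have "((\<lambda>x. integral {t/2..x} g + f (t/2)) has_real_derivative g t) (at t)"
      by (auto intro!: derivative_eq_intros)
    then show ?thesis
    proof (rule has_field_derivative_transform_within_open[where S = "{t/2<..}"])
      show "integral {t/2..x} g + f (t/2) = f x" if "x \<in> {t/2<..}" for x
        using int[of "t/2" x] that t by simp
    qed (use t in auto)
  qed
  have X': "(X has_real_derivative - \<xi>\<^sup>2 * X t + (- (N * \<xi>)) * Y t) (at t)" if "t > 0" for t
    by (rule deriv[OF X_int _ that]) (assumption+, intro continuous_intros X Y)
  have Y': "(Y has_real_derivative (N * \<xi>) * X t + (- \<xi>\<^sup>2) * Y t) (at t)" if "t > 0" for t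
    by (rule deriv[OF Y_int _ that]) (assumption+, intro continuous_intros X Y)
  \<comment> \<open>\<open>p + i * q\<close> is \<open>X + i * Y\<close> divided by the fundamental solution \<open>exp ((- \<xi>\<^sup>2 + i * N * \<xi>) * t)\<close>\<close>
  define p where "p t = exp (\<xi>\<^sup>2 * t) * (cos (N * \<xi> * t) * X t + sin (N * \<xi> * t) * Y t)" for t
  define q where "q t = exp (\<xi>\<^sup>2 * t) * (cos (N * \<xi> * t) * Y t - sin (N * \<xi> * t) * X t)" for t
  have "p t = p 0"
  proof (rule constant_if_deriv_zero_interior[OF _ _ \<open>t \<ge> 0\<close>])
    show "continuous_on {0..} p" unfolding p_def by (intro continuous_intros X Y)
    show "(p has_real_derivative 0) (at t)" if "t > 0" for t
      unfolding p_def[abs_def]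
      by (rule derivative_eq_intros X'[OF that] Y'[OF that] refl)+ (simp add: algebra_simps)
  qed
  moreover have "q t = q 0"
  proof (rule constant_if_deriv_zero_interior[OF _ _ \<open>t \<ge> 0\<close>])
    show "continuous_on {0..} q" unfolding q_def by (intro continuous_intros X Y)
    show "(q has_real_derivative 0) (at t)" if "t > 0" for t
      unfolding q_def[abs_def]
      by (rule derivative_eq_intros X'[OF that] Y'[OF that] refl)+ (simp add: algebra_simps)
  qed
  ultimately have pq: "p t = X 0" "q t = Y 0" by (simp_all add: p_def q_def)
  define e c s where "e = exp (\<xi>\<^sup>2 * t)" and "c = cos (N * \<xi> * t)" and "s = sin (N * \<xi> * t)"
  have cs: "c * c + s * s = 1" unfolding c_def s_def using sin_cos_squared_add3 by simp
  have "exp (- \<xi>\<^sup>2 * t) * e = 1" by (simp add: e_def exp_add[symmetric])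
  moreover have "c * p t - s * q t = e * X t * (c * c + s * s)" "s * p t + c * q t = e * Y t * (c * c + s * s)"
    unfolding p_def q_def e_def[symmetric] c_def[symmetric] s_def[symmetric] by (simp_all add: algebra_simps)
  ultimately have "X t = exp (- \<xi>\<^sup>2 * t) * (c * X 0 - s * Y 0)" "Y t = exp (- \<xi>\<^sup>2 * t) * (s * X 0 + c * Y 0)"
    unfolding cs pq by (simp_all add: mult.assoc[symmetric])
  then show "log_moment (\<lambda>x. u x t) (\<lambda>s. cos (\<xi> * s)) = exp (- \<xi>\<^sup>2 * t) *
      (cos (N * \<xi> * t) * log_moment (\<lambda>x. u x 0) (\<lambda>s. cos (\<xi> * s)) - sin (N * \<xi> * t) * log_moment (\<lambda>x. u x 0) (\<lambda>s. sin (\<xi> * s)))"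
    and "log_moment (\<lambda>x. u x t) (\<lambda>s. sin (\<xi> * s)) = exp (- \<xi>\<^sup>2 * t) *
      (sin (N * \<xi> * t) * log_moment (\<lambda>x. u x 0) (\<lambda>s. cos (\<xi> * s)) + cos (N * \<xi> * t) * log_moment (\<lambda>x. u x 0) (\<lambda>s. sin (\<xi> * s)))"
    by (simp_all add: X_def Y_def c_def s_def)
qed

text \<open>
  The two real equations for cosine and sine combined into one: the drift shifts the argument, the diffusion
  damps the amplitude.
\<close>

lemma weak_solution_fourier_phase:
  fixes u :: "'a::euclidean_space \<Rightarrow> real \<Rightarrow> real"
  assumes u: "weak_solution u0 u" and u0: "in_L12 u0" and "t \<ge> 0"
  shows "log_moment (\<lambda>x. u x t) (\<lambda>s. cos (\<xi> * s + d)) =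
    exp (- \<xi>\<^sup>2 * t) * log_moment u0 (\<lambda>s. cos (\<xi> * (s + (real DIM('a) - 2) * t) + d))"
proof -
  have u12: "in_L12 (\<lambda>x. u x t)" if "t \<ge> 0" for t
    using u that by (simp add: weak_solution_def continuous_in_L12_def)
  have ae: "AE x in lebesgue. u x 0 = u0 x" using u by (simp add: weak_solution_def)
  have m: "(\<lambda>s. cos (\<xi> * s)) \<in> borel_measurable borel" "(\<lambda>s. sin (\<xi> * s)) \<in> borel_measurable borel"
    by measurable
  have lin: "log_moment f (\<lambda>s. cos (\<xi> * s + \<beta>)) =
      cos \<beta> * log_moment f (\<lambda>s. cos (\<xi> * s)) + - sin \<beta> * log_moment f (\<lambda>s. sin (\<xi> * s))"
    if "in_L12 f" for f :: "'a \<Rightarrow> real" and \<beta>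
  proof -
    have "(\<lambda>s. cos (\<xi> * s + \<beta>)) = (\<lambda>s. cos \<beta> * cos (\<xi> * s) + - sin \<beta> * sin (\<xi> * s))"
      by (auto simp: cos_add)
    then show ?thesis
      using log_moment_linear[OF that m(1) abs_cos_le_one m(2) abs_sin_le_one, of "cos \<beta>" "- sin \<beta>"] by simp
  qed
  define \<gamma> where "\<gamma> = (real DIM('a) - 2) * \<xi> * t"
  have arg: "\<xi> * (s + (real DIM('a) - 2) * t) + d = \<xi> * s + (\<gamma> + d)" for s
    by (simp add: \<gamma>_def algebra_simps)
  show ?thesis
    unfolding arg lin[OF u12[OF \<open>t \<ge> 0\<close>]] lin[OF u0] weak_solution_fourier[OF u \<open>t \<ge> 0\<close>]
      log_moment_cong_AE[OF u12[OF order_refl] u0 ae m(1) abs_cos_le_one]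
      log_moment_cong_AE[OF u12[OF order_refl] u0 ae m(2) abs_sin_le_one] \<gamma>_def[symmetric]
    by (simp add: cos_add sin_add algebra_simps)
qed


section \<open>Lebesgue measure and radial functions in logarithmic coordinates\<close>

lemma unit_sphere_area_unit_ball_vol:
  "unit_sphere_area TYPE('a::euclidean_space) = real DIM('a) * unit_ball_vol (real DIM('a))"
proof -
  have "real DIM('a) / 2 > 0" by simp
  then have "real DIM('a) / 2 \<notin> \<int>\<^sub>\<le>\<^sub>0" by (meson nonpos_Ints_nonpos not_le)
  then show ?thesis
    by (simp add: unit_sphere_area_eq unit_ball_vol_def Gamma_plus1)
qed

lemma unit_sphere_area_pos: "unit_sphere_area TYPE('a::euclidean_space) > 0"
  by (simp add: unit_sphere_area_unit_ball_vol)

text \<open>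
  Both measures of a right half-line reduce to the volume of a ball.  The sign is chosen such that these
  half-lines have finite measure and thus determine the measure.
\<close>

lemma distr_neg_ln_norm:
  "distr (lborel :: 'a::euclidean_space measure) borel (\<lambda>x. - ln (norm x)) =
   density lborel (\<lambda>s. ennreal (unit_sphere_area TYPE('a) * exp (- (real DIM('a) * s))))"
  (is "?M = ?N")
proof (rule measure_eqI_lessThan)
  fix a :: real
  have "emeasure ?M {a<..} = emeasure lborel {x::'a. - ln (norm x) > a}"
    by (subst emeasure_distr) (auto simp: vimage_def)
  also have "\<dots> = emeasure lborel (ball (0::'a) (exp (- a)))"
  proof (rule emeasure_eq_AE)
    show "AE x in lborel. x \<in> {x::'a. - ln (norm x) > a} \<longleftrightarrow> x \<in> ball 0 (exp (- a))"
      using AE_lborel_singleton[of "0::'a"]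
    proof eventually_elim
      case (elim x)
      then show ?case using ln_less_cancel_iff[of "norm x" "exp (- a)"] by auto
    qed
    have "Measurable.pred borel (\<lambda>x::'a. - ln (norm x) > a)" by measurable
    then show "{x::'a. - ln (norm x) > a} \<in> sets lborel" by simp
  qed simp
  also have "\<dots> = ennreal (unit_ball_vol (real DIM('a)) * exp (- a) ^ DIM('a))"
    by (rule emeasure_ball) simp
  also have "unit_ball_vol (real DIM('a)) * exp (- a) ^ DIM('a) =
      0 - - (unit_ball_vol (real DIM('a)) * exp (- (real DIM('a) * a)))"
    by (simp add: exp_of_nat_mult[symmetric])
  also have "ennreal \<dots> = (\<integral>\<^sup>+s. ennreal (unit_sphere_area TYPE('a) * exp (- (real DIM('a) * s))) * indicator {a..} s \<partial>lborel)"
  proof (rule nn_integral_FTC_atLeast[symmetric])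
    show "((\<lambda>s. - (unit_ball_vol (real DIM('a)) * exp (- (real DIM('a) * s)))) has_real_derivative
        unit_sphere_area TYPE('a) * exp (- (real DIM('a) * s))) (at s)" for s
      by (auto intro!: derivative_eq_intros simp: unit_sphere_area_unit_ball_vol)
    have "((\<lambda>s. exp (- (real DIM('a) * s))) \<longlongrightarrow> 0) at_top"
      by (real_asymp simp: DIM_positive)
    from tendsto_minus[OF tendsto_mult[OF tendsto_const this]]
    show "((\<lambda>s. - (unit_ball_vol (real DIM('a)) * exp (- (real DIM('a) * s)))) \<longlongrightarrow> 0) at_top"
      by simp
  qed (use unit_sphere_area_pos[where 'a='a] in \<open>auto simp: less_imp_le\<close>)
  also have "\<dots> = emeasure ?N {a<..}"
  proof (subst emeasure_density)
    show "(\<integral>\<^sup>+s. ennreal (unit_sphere_area TYPE('a) * exp (- (real DIM('a) * s))) * indicator {a..} s \<partial>lborel) =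
        (\<integral>\<^sup>+s. ennreal (unit_sphere_area TYPE('a) * exp (- (real DIM('a) * s))) * indicator {a<..} s \<partial>lborel)"
      using AE_lborel_singleton[of a]
      by (intro nn_integral_cong_AE) (auto elim!: eventually_mono simp: indicator_def)
  qed auto
  finally show "emeasure ?M {a<..} = emeasure ?N {a<..}" .
  show "emeasure ?M {a<..} < \<infinity>"
    using \<open>emeasure ?M {a<..} = emeasure lborel {x::'a. - ln (norm x) > a}\<close>
      \<open>emeasure lborel {x::'a. - ln (norm x) > a} = emeasure lborel (ball (0::'a) (exp (- a)))\<close>
      emeasure_ball[of "exp (- a)" "0::'a"] by simp
qed auto

text \<open>
  Integration in polar coordinates, for functions of the norm only, in the variable \<open>ln |x|\<close>.
\<close>

lemma distr_ln_norm:
  "distr (lborel :: 'a::euclidean_space measure) borel (\<lambda>x. ln (norm x)) =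
   density lborel (\<lambda>s. ennreal (unit_sphere_area TYPE('a) * exp (real DIM('a) * s)))"
proof (rule measure_eqI)
  fix S :: "real set" assume "S \<in> sets (distr (lborel :: 'a measure) borel (\<lambda>x. ln (norm x)))"
  then have S[measurable]: "S \<in> sets borel" by simp
  let ?w = "\<lambda>s. ennreal (unit_sphere_area TYPE('a) * exp (- (real DIM('a) * s)))"
  have [measurable]: "(\<lambda>s. indicator S (- s) :: ennreal) \<in> borel_measurable borel"
    by measurable
  have "emeasure (distr (lborel :: 'a measure) borel (\<lambda>x. ln (norm x))) S = (\<integral>\<^sup>+x. indicator S (ln (norm x)) \<partial>(lborel :: 'a measure))"
    by (subst nn_integral_indicator[symmetric], simp, subst nn_integral_distr) auto
  also have "\<dots> = (\<integral>\<^sup>+y. indicator S (- y) \<partial>distr (lborel :: 'a measure) borel (\<lambda>x. - ln (norm x)))"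
    by (subst nn_integral_distr) auto
  also have "\<dots> = (\<integral>\<^sup>+y. ?w y * indicator S (- y) \<partial>lborel)"
    unfolding distr_neg_ln_norm by (subst nn_integral_density) auto
  also have "\<dots> = (\<integral>\<^sup>+y. ?w (- y) * indicator S y \<partial>lborel)"
    by (subst nn_integral_real_affine[where c = "-1" and t = 0]) auto
  also have "\<dots> = emeasure (density lborel (\<lambda>s. ennreal (unit_sphere_area TYPE('a) * exp (real DIM('a) * s)))) S"
    by (subst emeasure_density) auto
  finally show "emeasure (distr (lborel :: 'a measure) borel (\<lambda>x. ln (norm x))) S =
    emeasure (density lborel (\<lambda>s. ennreal (unit_sphere_area TYPE('a) * exp (real DIM('a) * s)))) S" .
qed simp

lemma AE_ln_norm:
  assumes "AE s in lborel. P s"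
  shows "AE x in (lborel :: 'a::euclidean_space measure). P (ln (norm x))"
proof -
  from assms obtain N where N: "N \<in> null_sets (lborel :: real measure)" "\<And>s. \<not> P s \<Longrightarrow> s \<in> N"
    unfolding eventually_ae_filter by auto
  have [measurable]: "N \<in> sets borel" using N(1) by auto
  have "AE s in lborel. s \<notin> N" using N(1) by (rule AE_not_in)
  then have "AE s in distr (lborel :: 'a measure) borel (\<lambda>x. ln (norm x)). s \<notin> N"
    unfolding distr_ln_norm by (subst AE_density) (auto elim: eventually_mono)
  then have "AE x in (lborel :: 'a measure). ln (norm x) \<notin> N"
    by (subst (asm) AE_distr_iff) auto
  then show ?thesis by eventually_elim (use N(2) in blast)
qed

lemma AE_lborel_affine:
  fixes t :: "'a::euclidean_space"
  assumes "AE x in lborel. P x" "c \<noteq> 0"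
  shows "AE x in lborel. P (t + c *\<^sub>R x)"
proof -
  from assms(1) obtain N where N: "N \<in> null_sets (lborel :: 'a measure)" "\<And>s. \<not> P s \<Longrightarrow> s \<in> N"
    unfolding eventually_ae_filter by auto
  have [measurable]: "N \<in> sets borel" using N(1) by auto
  have "AE s in lborel. s \<notin> N" using N(1) by (rule AE_not_in)
  then have "AE s in density (distr lborel borel (\<lambda>x. t + c *\<^sub>R x)) (\<lambda>_. ennreal (\<bar>c\<bar>^DIM('a))). s \<notin> N"
    by (subst lborel_affine[OF assms(2), of t, symmetric])
  then have "AE s in distr lborel borel (\<lambda>x. t + c *\<^sub>R x). s \<notin> N"
    by (subst (asm) AE_density) (use assms(2) in auto)
  then have "AE x in lborel. t + c *\<^sub>R x \<notin> N"
    by (subst (asm) AE_distr_iff) auto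
  then show ?thesis by eventually_elim (use N(2) in blast)
qed

text \<open>
  The function \<open>g\<close> carries no measurability of its own.  A Borel version of it is read off from the values
  of \<open>h\<close> along a generic ray, after a modification of \<open>h\<close> on a null set.
\<close>

lemma radial_borel_representative:
  fixes h :: "'a::euclidean_space \<Rightarrow> real"
  assumes h: "h \<in> borel_measurable lebesgue" and g: "AE x in lebesgue. h x = g (norm x)"
  obtains k where "k \<in> borel_measurable borel" "AE x in lborel. h x = k (ln (norm x))"
proof -
  obtain h' where h'[measurable]: "h' \<in> borel_measurable borel" and hh': "AE x in lborel. h x = h' x"
    using completion_ex_borel_measurable_real[OF h] by auto
  have "AE x in lborel. h' x = g (norm x)"
    using g[unfolded AE_completion_iff] hh' by eventually_elim simp
  then obtain N where N: "N \<in> null_sets (lborel :: 'a measure)" "\<And>x. h' x \<noteq> g (norm x) \<Longrightarrow> x \<in> N"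
    unfolding eventually_ae_filter by auto
  have [measurable]: "N \<in> sets borel" using N(1) by auto
  \<comment> \<open>dilations preserve null sets, so by Fubini almost every ray avoids \<open>N\<close> almost everywhere\<close>
  have "AE x in lborel. exp s *\<^sub>R x \<notin> N" for s :: real
    using AE_lborel_affine[OF AE_not_in[OF N(1)], of "exp s" 0] by simp
  then have *: "AE s in lborel. AE x in lborel. exp s *\<^sub>R x \<notin> N"
    by simp
  have "Measurable.pred (lborel \<Otimes>\<^sub>M lborel) (\<lambda>z :: real \<times> 'a. exp (fst z) *\<^sub>R snd z \<notin> N)"
    by measurable
  then have "(AE s in lborel. AE x in lborel. exp s *\<^sub>R (x :: 'a) \<notin> N) \<longleftrightarrow> (AE x in lborel. AE s in lborel. exp s *\<^sub>R (x :: 'a) \<notin> N)"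
    by (intro lborel_pair.AE_commute) (simp add: pred_def)
  with * have "AE x in lborel. AE s in lborel. exp s *\<^sub>R (x :: 'a) \<notin> N" by simp
  then have "AE x in lborel. x \<noteq> 0 \<and> (AE s in lborel. exp s *\<^sub>R (x :: 'a) \<notin> N)"
    using AE_lborel_singleton[of "0::'a"] by eventually_elim simp
  moreover have "ae_filter (lborel :: 'a measure) \<noteq> bot"
    by (simp add: ae_filter_eq_bot_iff emeasure_lborel_UNIV)
  ultimately obtain x0 :: 'a where x0: "x0 \<noteq> 0" "AE s in lborel. exp s *\<^sub>R x0 \<notin> N"
    using eventually_happens' by blast
  \<comment> \<open>read the Borel function \<open>h'\<close> along one such ray, parametrised by the logarithm of the norm\<close>
  define k where "k s = h' (exp (- ln (norm x0) + 1 *\<^sub>R s) *\<^sub>R x0)" for s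
  have k[measurable]: "k \<in> borel_measurable borel" unfolding k_def by measurable
  have "AE s in lborel. exp (- ln (norm x0) + 1 *\<^sub>R s) *\<^sub>R x0 \<notin> N"
    by (rule AE_lborel_affine[OF x0(2)]) simp
  then have "AE s in lborel. k s = g (exp s)"
  proof eventually_elim
    case (elim s)
    then have "k s = g (norm (exp (- ln (norm x0) + 1 *\<^sub>R s) *\<^sub>R x0))"
      using N(2) unfolding k_def by blast
    also have "norm (exp (- ln (norm x0) + 1 *\<^sub>R s) *\<^sub>R x0) = exp s"
      using x0(1) by (simp add: exp_diff)
    finally show ?case .
  qed
  then have "AE x in lborel. k (ln (norm (x::'a))) = g (exp (ln (norm x)))"
    by (rule AE_ln_norm)
  then have "AE x in lborel. h x = k (ln (norm x))"
    using g[unfolded AE_completion_iff] AE_lborel_singleton[of "0::'a"]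
    by eventually_elim simp
  with k show ?thesis by (rule that)
qed

lemma integral_ln_norm:
  fixes \<phi> :: "real \<Rightarrow> real"
  assumes [measurable]: "\<phi> \<in> borel_measurable borel"
  shows "(LINT x|(lborel :: 'a::euclidean_space measure). \<phi> (ln (norm x))) =
      (LINT s|lborel. unit_sphere_area TYPE('a) * exp (real DIM('a) * s) * \<phi> s)" (is ?eq)
    and "integrable (lborel :: 'a measure) (\<lambda>x. \<phi> (ln (norm x))) \<longleftrightarrow>
      integrable lborel (\<lambda>s. unit_sphere_area TYPE('a) * exp (real DIM('a) * s) * \<phi> s)" (is ?int)
proof -
  have pos: "AE s in lborel. 0 \<le> unit_sphere_area TYPE('a) * exp (real DIM('a) * s)"
    using unit_sphere_area_pos[where 'a='a] by (simp add: less_imp_le)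
  have "(LINT x|(lborel :: 'a measure). \<phi> (ln (norm x))) = (LINT s|distr (lborel :: 'a measure) borel (\<lambda>x. ln (norm x)). \<phi> s)"
    by (rule integral_distr[symmetric]) auto
  then show ?eq
    unfolding distr_ln_norm by (subst (asm) integral_density[OF _ _ pos]) auto
  have "integrable (lborel :: 'a measure) (\<lambda>x. \<phi> (ln (norm x))) \<longleftrightarrow> integrable (distr (lborel :: 'a measure) borel (\<lambda>x. ln (norm x))) \<phi>"
    by (rule integrable_distr_eq[symmetric]) auto
  then show ?int
    unfolding distr_ln_norm by (subst (asm) integrable_density[OF _ _ pos]) auto
qed

text \<open>
  The factor \<open>exp (N s)\<close> of polar coordinates and the weight \<open>1 / |x|\<^sup>2 = exp (- 2 s)\<close> combine into the exponent \<open>N - 2\<close>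
  of the density on the line.
\<close>

lemma log_moment_radial:
  fixes h :: "'a::euclidean_space \<Rightarrow> real"
  assumes h: "in_L12 h" and k: "k \<in> borel_measurable borel" "AE x in lborel. h x = k (ln (norm x))"
    and f: "f \<in> borel_measurable borel" "\<And>s. \<bar>f s\<bar> \<le> C"
  defines "p \<equiv> \<lambda>s. unit_sphere_area TYPE('a) * exp ((real DIM('a) - 2) * s) * k s"
  shows "integrable lborel (\<lambda>s. p s * f s)" and "log_moment h f = (LINT s|lborel. p s * f s)"
proof -
  let ?\<phi> = "\<lambda>s. k s * f s * exp (- 2 * s)"
  note [measurable] = k(1) f(1)
  have \<phi>: "unit_sphere_area TYPE('a) * exp (real DIM('a) * s) * ?\<phi> s = p s * f s" for s
    by (simp add: p_def left_diff_distrib exp_diff exp_minus divide_inverse)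
  have m: "(\<lambda>x::'a. ?\<phi> (ln (norm x))) \<in> borel_measurable lborel" by measurable
  have int: "integrable lebesgue (\<lambda>x. h x * f (ln (norm x)) / (norm x)\<^sup>2)"
    by (rule in_L12_log_integrable[OF h f])
  have ae: "AE x in lebesgue. h x * f (ln (norm x)) / (norm x)\<^sup>2 = ?\<phi> (ln (norm x))"
    unfolding AE_completion_iff using k(2) AE_lborel_singleton[of "0::'a"]
  proof eventually_elim
    case (elim x)
    then show ?case using exp_minus_2_ln[of "norm x"] by simp
  qed
  have "integrable lebesgue (\<lambda>x::'a. ?\<phi> (ln (norm x)))"
    using integrable_cong_AE[OF borel_measurable_integrable[OF int] measurable_completion[OF m] ae] int by blast
  then have "integrable lborel (\<lambda>x::'a. ?\<phi> (ln (norm x)))"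
    using integrable_completion[OF m] by blast
  then show "integrable lborel (\<lambda>s. p s * f s)"
    using integral_ln_norm(2)[of ?\<phi>, where 'a='a] unfolding \<phi> by simp
  have "log_moment h f = (LINT x|lebesgue. ?\<phi> (ln (norm (x :: 'a))))"
    unfolding log_moment_def
    by (rule Bochner_Integration.integral_cong_AE[OF borel_measurable_integrable[OF int] measurable_completion[OF m] ae])
  also have "\<dots> = (LINT x|lborel. ?\<phi> (ln (norm (x :: 'a))))"
    by (rule integral_completion[OF m])
  also have "\<dots> = (LINT s|lborel. p s * f s)"
    using integral_ln_norm(1)[of ?\<phi>, where 'a='a] unfolding \<phi> by simp
  finally show "log_moment h f = (LINT s|lborel. p s * f s)" .
qed


section \<open>Mixtures of normal densities\<close>

text \<open>
  Real and imaginary part of the characteristic function of the standard normal distribution.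
\<close>

lemma std_normal_cos: "(LINT x|lborel. std_normal_density x * cos (\<xi> * x)) = exp (- \<xi>\<^sup>2 / 2)"
  and std_normal_sin: "(LINT x|lborel. std_normal_density x * sin (\<xi> * x)) = 0"
proof -
  have "complex_of_real (exp (- (\<xi>^2) / 2)) = char std_normal_distribution \<xi>"
    by (simp add: char_std_normal_distribution)
  also have "\<dots> = (CLINT x|lborel. std_normal_density x *\<^sub>R iexp (\<xi> * x))"
    unfolding char_def by (subst integral_density) (auto simp: normal_density_nonneg)
  finally have c: "(CLINT x|lborel. std_normal_density x *\<^sub>R iexp (\<xi> * x)) = complex_of_real (exp (- (\<xi>^2) / 2))" ..
  have int: "complex_integrable lborel (\<lambda>x. std_normal_density x *\<^sub>R iexp (\<xi> * x))"
    by (rule Bochner_Integration.integrable_bound[OF integrable_std_normal_moment[of 0]])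
       (auto simp: norm_mult)
  show "(LINT x|lborel. std_normal_density x * cos (\<xi> * x)) = exp (- \<xi>\<^sup>2 / 2)"
    using arg_cong[OF c, of Re] int by (simp add: Re_exp flip: integral_Re)
  show "(LINT x|lborel. std_normal_density x * sin (\<xi> * x)) = 0"
    using arg_cong[OF c, of Im] int by (simp add: Im_exp flip: integral_Im)
qed

lemma normal_density_cos:
  assumes "\<sigma> > 0"
  shows "(LINT s|lborel. normal_density \<mu> \<sigma> (s - z) * cos (\<xi> * s + d)) =
    exp (- (\<sigma> * \<xi>)\<^sup>2 / 2) * cos (\<xi> * (z + \<mu>) + d)"
proof -
  have nd: "normal_density \<mu> \<sigma> (z + \<mu> + \<sigma> * y - z) = std_normal_density y / \<sigma>" for y
    using assms by (simp add: normal_density_def real_sqrt_mult power_mult_distrib)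
  have int: "integrable lborel (\<lambda>y. std_normal_density y * f (\<sigma> * \<xi> * y))" if "f \<in> {sin, cos}" for f :: "real \<Rightarrow> real"
    by (rule integrable_mult_bounded[where K = 1])
       (use that integrable_normal_density[of 1 0] in auto)
  have cos: "\<sigma> * (std_normal_density y / \<sigma> * cos (\<xi> * (z + \<mu> + \<sigma> * y) + d)) =
      cos (\<xi> * (z + \<mu>) + d) * (std_normal_density y * cos (\<sigma> * \<xi> * y)) -
        sin (\<xi> * (z + \<mu>) + d) * (std_normal_density y * sin (\<sigma> * \<xi> * y))" for y
  proof -
    have "\<xi> * (z + \<mu> + \<sigma> * y) + d = (\<xi> * (z + \<mu>) + d) + \<sigma> * \<xi> * y" by (simp add: algebra_simps)
    then have "cos (\<xi> * (z + \<mu> + \<sigma> * y) + d) =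
        cos (\<xi> * (z + \<mu>) + d) * cos (\<sigma> * \<xi> * y) - sin (\<xi> * (z + \<mu>) + d) * sin (\<sigma> * \<xi> * y)"
      by (simp only: cos_add)
    then show ?thesis using assms by (simp only:) (simp add: right_diff_distrib)
  qed
  have "(LINT s|lborel. normal_density \<mu> \<sigma> (s - z) * cos (\<xi> * s + d)) =
      \<sigma> * (LINT y|lborel. std_normal_density y / \<sigma> * cos (\<xi> * (z + \<mu> + \<sigma> * y) + d))"
    using lborel_integral_real_affine[of \<sigma> "\<lambda>s. normal_density \<mu> \<sigma> (s - z) * cos (\<xi> * s + d)" "z + \<mu>"] assms
    unfolding nd by simp
  also have "\<dots> = (LINT y|lborel. \<sigma> * (std_normal_density y / \<sigma> * cos (\<xi> * (z + \<mu> + \<sigma> * y) + d)))"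
    by (rule integral_mult_right_zero[symmetric])
  also have "\<dots> = (LINT y|lborel. cos (\<xi> * (z + \<mu>) + d) * (std_normal_density y * cos (\<sigma> * \<xi> * y)) -
        sin (\<xi> * (z + \<mu>) + d) * (std_normal_density y * sin (\<sigma> * \<xi> * y)))"
    unfolding cos ..
  also have "\<dots> = exp (- (\<sigma> * \<xi>)\<^sup>2 / 2) * cos (\<xi> * (z + \<mu>) + d)"
    using std_normal_cos[of "\<sigma> * \<xi>"] std_normal_sin[of "\<sigma> * \<xi>"]
    by (subst Bochner_Integration.integral_diff) (simp_all add: int)
  finally show ?thesis .
qed

text \<open>
  The mixture is the law of an independent sum of a normal variable and \<open>Z\<close> under the density \<open>w\<close>, so its
  Fourier transform factorises.
\<close>

lemma normal_mixture:
  fixes w :: "'a::euclidean_space \<Rightarrow> real"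
  assumes w: "integrable lborel w" and Z: "Z \<in> borel_measurable borel" and "\<sigma> > 0"
  shows "integrable lborel (\<lambda>s. LINT x|lborel. normal_density \<mu> \<sigma> (s - Z x) * w x)" (is ?int)
    and "(LINT s|lborel. (LINT x|lborel. normal_density \<mu> \<sigma> (s - Z x) * w x) * cos (\<xi> * s + d)) =
      exp (- (\<sigma> * \<xi>)\<^sup>2 / 2) * (LINT x|lborel. w x * cos (\<xi> * (Z x + \<mu>) + d))" (is ?eq)
proof -
  have [measurable]: "w \<in> borel_measurable borel" "Z \<in> borel_measurable borel"
    using w Z by auto
  have shift: "has_bochner_integral lborel (\<lambda>s. normal_density \<mu> \<sigma> (s - z)) 1" for z
  proof -
    have "integrable lborel (\<lambda>s. normal_density \<mu> \<sigma> (- z + 1 * s))"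
      by (rule lborel_integrable_real_affine[OF integrable_normal_density[OF \<open>\<sigma> > 0\<close>]]) simp
    moreover have "(LINT s|lborel. normal_density \<mu> \<sigma> (s - z)) = 1"
      using lborel_integral_real_affine[of 1 "normal_density \<mu> \<sigma>" "- z"] integral_normal_density[OF \<open>\<sigma> > 0\<close>]
      by (simp add: algebra_simps)
    ultimately show ?thesis by (simp add: has_bochner_integral_iff algebra_simps)
  qed
  have int: "integrable (lborel \<Otimes>\<^sub>M lborel) (case_prod (\<lambda>x s. normal_density \<mu> \<sigma> (s - Z x) * w x))"
  proof (rule lborel_pair.Fubini_integrable)
    show "case_prod (\<lambda>x s. normal_density \<mu> \<sigma> (s - Z x) * w x) \<in> borel_measurable (lborel \<Otimes>\<^sub>M lborel)"
      unfolding normal_density_def by measurable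
    have "(LINT s|lborel. norm (normal_density \<mu> \<sigma> (s - Z x) * w x)) = \<bar>w x\<bar>" for x
    proof -
      have "(LINT s|lborel. norm (normal_density \<mu> \<sigma> (s - Z x) * w x)) = (LINT s|lborel. normal_density \<mu> \<sigma> (s - Z x) * \<bar>w x\<bar>)"
        by (simp add: abs_mult normal_density_nonneg)
      then show ?thesis using has_bochner_integral_integral_eq[OF shift[of "Z x"]] by simp
    qed
    then show "integrable lborel (\<lambda>x. LINT s|lborel. norm (case (x, s) of (x, s) \<Rightarrow> normal_density \<mu> \<sigma> (s - Z x) * w x))"
      using w by simp
    have "integrable lborel (\<lambda>s. normal_density \<mu> \<sigma> (s - Z x) * w x)" for x
      using shift[of "Z x"] by (intro integrable_mult_left) (auto simp: has_bochner_integral_iff)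
    then show "AE x in lborel. integrable lborel (\<lambda>s. case (x, s) of (x, s) \<Rightarrow> normal_density \<mu> \<sigma> (s - Z x) * w x)"
      by simp
  qed
  show ?int by (rule lborel_pair.integrable_snd[OF int])
  have "integrable (lborel \<Otimes>\<^sub>M lborel) (\<lambda>z. (case z of (x, s) \<Rightarrow> normal_density \<mu> \<sigma> (s - Z x) * w x) * cos (\<xi> * snd z + d))"
    by (rule integrable_mult_bounded[OF int, where K = 1]) auto
  then have int': "integrable (lborel \<Otimes>\<^sub>M lborel) (case_prod (\<lambda>x s. normal_density \<mu> \<sigma> (s - Z x) * w x * cos (\<xi> * s + d)))"
    by (simp add: case_prod_beta')
  have "(LINT s|lborel. (LINT x|lborel. normal_density \<mu> \<sigma> (s - Z x) * w x) * cos (\<xi> * s + d)) =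
    (LINT s|lborel. LINT x|lborel. normal_density \<mu> \<sigma> (s - Z x) * w x * cos (\<xi> * s + d))"
    by simp
  also have "\<dots> = (LINT x|lborel. LINT s|lborel. normal_density \<mu> \<sigma> (s - Z x) * w x * cos (\<xi> * s + d))"
    by (rule lborel_pair.Fubini_integral[OF int'])
  also have "\<dots> = (LINT x|lborel. w x * (LINT s|lborel. normal_density \<mu> \<sigma> (s - Z x) * cos (\<xi> * s + d)))"
    by (simp add: mult.assoc mult.left_commute[of _ "w _"])
  also have "\<dots> = exp (- (\<sigma> * \<xi>)\<^sup>2 / 2) * (LINT x|lborel. w x * cos (\<xi> * (Z x + \<mu>) + d))"
    unfolding normal_density_cos[OF \<open>\<sigma> > 0\<close>] mult.left_commute[of "w _"] by (rule integral_mult_right_zero)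
  finally show ?eq .
qed

text \<open>
  Levy's uniqueness theorem for characteristic functions, for densities of arbitrary equal mass.
\<close>

lemma densities_eq_of_cos_integrals:
  fixes f g :: "real \<Rightarrow> real"
  assumes f: "integrable lborel f" "\<And>s. f s \<ge> 0" and g: "integrable lborel g" "\<And>s. g s \<ge> 0"
    and eq: "\<And>\<xi> d. (LINT s|lborel. f s * cos (\<xi> * s + d)) = (LINT s|lborel. g s * cos (\<xi> * s + d))"
  shows "AE s in lborel. f s = g s"
proof -
  define m where "m = (LINT s|lborel. f s)"
  have m: "(LINT s|lborel. g s) = m" using eq[of 0 0] by (simp add: m_def)
  have "m \<ge> 0" using f(2) by (simp add: m_def)
  show ?thesis
  proof (cases "m = 0")
    case True
    then have "AE s in lborel. f s = 0" "AE s in lborel. g s = 0"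
      using integral_nonneg_eq_0_iff_AE[OF f(1)] integral_nonneg_eq_0_iff_AE[OF g(1)] f(2) g(2) m m_def by auto
    then show ?thesis by eventually_elim simp
  next
    case False
    with \<open>m \<ge> 0\<close> have "m > 0" by simp
    \<comment> \<open>normalised to mass 1, the phases 0 and \<open>- pi / 2\<close> give real and imaginary part of the characteristic function\<close>
    define D where "D h = density lborel (\<lambda>s. ennreal (h s / m))" for h :: "real \<Rightarrow> real"
    have real: "real_distribution (D h)"
      and char: "char (D h) \<xi> = Complex ((LINT s|lborel. h s * cos (\<xi> * s + 0)) / m) ((LINT s|lborel. h s * cos (\<xi> * s + - (pi / 2))) / m)"
      if h: "integrable lborel h" "\<And>s. h s \<ge> 0" "(LINT s|lborel. h s) = m" for h \<xi>
    proof -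
      have [measurable]: "h \<in> borel_measurable borel" using h(1) by auto
      have "emeasure (D h) UNIV = (\<integral>\<^sup>+s. ennreal (h s / m) \<partial>lborel)"
        by (simp add: D_def emeasure_density)
      also have "\<dots> = ennreal (LINT s|lborel. h s / m)"
        by (rule nn_integral_eq_integral) (use h \<open>m > 0\<close> in auto)
      also have "\<dots> = 1" using h(3) \<open>m > 0\<close> by simp
      finally have "prob_space (D h)" by (intro prob_spaceI) (simp add: D_def)
      then show "real_distribution (D h)"
        by (intro real_distribution.intro real_distribution_axioms.intro) (auto simp: D_def)
      have int: "complex_integrable lborel (\<lambda>s. (h s / m) *\<^sub>R iexp (\<xi> * s))"
        by (rule Bochner_Integration.integrable_bound[of _ "\<lambda>s. h s / m"]) (use h \<open>m > 0\<close> in \<open>auto simp: norm_mult\<close>)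
      have "char (D h) \<xi> = (CLINT s|lborel. (h s / m) *\<^sub>R iexp (\<xi> * s))"
        unfolding char_def D_def by (subst integral_density) (use h \<open>m > 0\<close> in auto)
      moreover have "Re (CLINT s|lborel. (h s / m) *\<^sub>R iexp (\<xi> * s)) = (LINT s|lborel. h s * cos (\<xi> * s + 0)) / m"
        using int by (simp add: Re_exp flip: integral_Re)
      moreover have "Im (CLINT s|lborel. (h s / m) *\<^sub>R iexp (\<xi> * s)) = (LINT s|lborel. h s * cos (\<xi> * s + - (pi / 2))) / m"
        using int by (simp add: Im_exp cos_diff flip: integral_Im)
      ultimately show "char (D h) \<xi> = Complex ((LINT s|lborel. h s * cos (\<xi> * s + 0)) / m) ((LINT s|lborel. h s * cos (\<xi> * s + - (pi / 2))) / m)"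
        by (simp add: complex_eq_iff)
    qed
    have "D f = D g"
      by (rule Levy_uniqueness[OF real[OF f m_def[symmetric]] real[OF g m]])
         (rule ext, simp only: char[OF f m_def[symmetric]] char[OF g m] eq)
    then have "AE s in lborel. ennreal (f s / m) = ennreal (g s / m)"
      unfolding D_def using f(1) g(1) by (subst (asm) sigma_finite_measure.density_unique_iff[OF sigma_finite_lborel]) auto
    then show ?thesis
      by eventually_elim (use f(2) g(2) \<open>m > 0\<close> in simp)
  qed
qed


section \<open>Representation of radial solutions\<close>

text \<open>
  Completing the square: passing between densities with respect to \<open>exp (b s) ds\<close> and with respect to \<open>ds\<close> reverses
  the drift of the Gaussian.
\<close>

lemma gaussian_tilt:
  assumes "t > 0"
  shows "exp (- b * S) * normal_density (b * t) (sqrt (2 * t)) (S - Z) =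
    exp (- b * Z) * (exp (- (S - Z + b * t)\<^sup>2 / (4 * t)) / sqrt (4 * pi * t))"
proof -
  have "- b * S + - (S - Z - b * t)\<^sup>2 / (4 * t) = - b * Z + - (S - Z + b * t)\<^sup>2 / (4 * t)"
    using assms by (simp add: field_simps power2_eq_square)
  then have "exp (- b * S) * exp (- (S - Z - b * t)\<^sup>2 / (4 * t)) = exp (- b * Z) * exp (- (S - Z + b * t)\<^sup>2 / (4 * t))"
    by (simp only: exp_add[symmetric])
  then show ?thesis
    using assms by (simp add: normal_density_def)
qed

text \<open>
  The Fourier transform of the density of \<open>u(x, t) / |x|\<^sup>2 dx\<close> in the variable \<open>ln |x|\<close> is that of the mixture of
  normal densities with mean \<open>(N - 2) t\<close> and variance \<open>2 t\<close> directed by the initial measure.  The two densities therefore agree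
  almost everywhere, and dividing by the weight \<open>exp ((N - 2) s)\<close> turns the weight \<open>|z|\<^sup>-\<^sup>2\<close> of the initial
  function into \<open>|z|\<^sup>-\<^sup>N\<close>.
\<close>

lemma radial_weak_solution_formula:
  fixes u :: "'a::euclidean_space \<Rightarrow> real \<Rightarrow> real"
  assumes dim: "DIM('a) \<ge> 2"
    and u: "weak_solution u0 u" and u0: "in_L12 u0" "AE x in lebesgue. u0 x \<ge> 0"
    and rad: "radially_symmetric u" and "t > 0"
  shows "AE x in lebesgue. u x t = (LINT z|lebesgue.
     exp (- (ln (norm x) - ln (norm z) + (real DIM('a) - 2) * t)\<^sup>2 / (4 * t)) / sqrt (4 * pi * t) * (u0 z / norm z ^ DIM('a)))
     / unit_sphere_area TYPE('a)"
proof -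
  define b where "b = real DIM('a) - 2"
  define \<omega> where "\<omega> = unit_sphere_area TYPE('a)"
  have \<omega>: "\<omega> > 0" unfolding \<omega>_def by (rule unit_sphere_area_pos)
  have u12: "in_L12 (\<lambda>x. u x t)" and unn: "AE x in lebesgue. u x t \<ge> 0"
    using u \<open>t > 0\<close> by (auto simp: weak_solution_def continuous_in_L12_def)
  \<comment> \<open>a nonnegative Borel version of the initial density with respect to Lebesgue measure\<close>
  obtain w where w: "w \<in> borel_measurable borel" "\<And>x. w x \<ge> 0" "AE x in lborel. w x = u0 x / (norm x)\<^sup>2" "integrable lborel w"
  proof -
    have int0: "integrable lebesgue (\<lambda>x. \<bar>u0 x\<bar> / (norm x)\<^sup>2)" using u0(1) by (simp add: in_L12_def)
    then obtain w where w: "w \<in> borel_measurable lborel" "AE x in lborel. \<bar>u0 x\<bar> / (norm x)\<^sup>2 = w x"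
      using completion_ex_borel_measurable_real[of "\<lambda>x. \<bar>u0 x\<bar> / (norm x)\<^sup>2" lborel] by auto
    let ?w = "\<lambda>x. max 0 (w x)"
    have m: "?w \<in> borel_measurable lborel" using w(1) by simp
    have ae': "AE x in lebesgue. \<bar>u0 x\<bar> / (norm x)\<^sup>2 = ?w x"
      unfolding AE_completion_iff using w(2)
    proof eventually_elim
      case (elim x)
      have "0 \<le> \<bar>u0 x\<bar> / (norm x)\<^sup>2" by simp
      then show ?case unfolding elim by simp
    qed
    have ae: "AE x in lborel. ?w x = u0 x / (norm x)\<^sup>2"
      using ae'[unfolded AE_completion_iff] u0(2)[unfolded AE_completion_iff]
    proof eventually_elim
      case (elim x)
      then show ?case by (metis abs_of_nonneg)
    qed
    have "integrable lebesgue ?w"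
      using integrable_cong_AE[OF borel_measurable_integrable[OF int0] measurable_completion[OF m] ae'] int0 by blast
    then have "integrable lborel ?w" using integrable_completion[OF m] by blast
    then show ?thesis using m ae by (intro that[of ?w]) auto
  qed
  obtain g where "AE x in lebesgue. u x t = g (norm x) t"
    using rad \<open>t > 0\<close> by (auto simp: radially_symmetric_def)
  then obtain k0 where k0: "k0 \<in> borel_measurable borel" "AE x in lborel. u x t = k0 (ln (norm x))"
    using radial_borel_representative[of "\<lambda>x. u x t" "\<lambda>r. g r t"] u12 by (auto simp: in_L12_def)
  define k where "k s = max 0 (k0 s)" for s
  have k: "k \<in> borel_measurable borel" "\<And>s. k s \<ge> 0" using k0(1) by (auto simp: k_def[abs_def])
  have uk: "AE x in lborel. u x t = k (ln (norm x))"
    using k0(2) unn[unfolded AE_completion_iff] by eventually_elim (simp add: k_def)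
  \<comment> \<open>\<open>p\<close> is the density of \<open>u(\<cdot>, t) / |x|\<^sup>2 dx\<close> in the variable \<open>ln |x|\<close>; \<open>q\<close> is the mixture of normal
    densities that it has to equal\<close>
  define p where "p s = \<omega> * exp (b * s) * k s" for s
  define q where "q s = (LINT z|lborel. normal_density (b * t) (sqrt (2 * t)) (s - ln (norm z)) * w z)" for s
  have \<sigma>: "sqrt (2 * t) > 0" using \<open>t > 0\<close> by simp
  have Z: "(\<lambda>z::'a. ln (norm z)) \<in> borel_measurable borel" by measurable
  note mix = normal_mixture[OF w(4) Z \<sigma>, of "b * t"]
  have "AE s in lborel. p s = q s"
  proof (rule densities_eq_of_cos_integrals)
    show "integrable lborel p"
      using log_moment_radial(1)[OF u12 k(1) uk, of "\<lambda>s. 1" 1] unfolding p_def \<omega>_def b_def by simp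
    show "p s \<ge> 0" for s using \<omega> k(2) by (simp add: p_def)
    show "integrable lborel q" unfolding q_def by (rule mix(1))
    show "q s \<ge> 0" for s
      unfolding q_def using w(2) by (intro integral_nonneg_AE) (simp add: normal_density_nonneg)
    show "(LINT s|lborel. p s * cos (\<xi> * s + d)) = (LINT s|lborel. q s * cos (\<xi> * s + d))" for \<xi> d
    proof -
      have m: "(\<lambda>s. cos (\<xi> * s + d)) \<in> borel_measurable borel" "(\<lambda>s. cos (\<xi> * (s + b * t) + d)) \<in> borel_measurable borel"
        by measurable
      have "(LINT s|lborel. p s * cos (\<xi> * s + d)) = log_moment (\<lambda>x. u x t) (\<lambda>s. cos (\<xi> * s + d))"
        unfolding p_def \<omega>_def b_def by (rule log_moment_radial(2)[OF u12 k(1) uk m(1) abs_cos_le_one, symmetric])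
      also have "\<dots> = exp (- \<xi>\<^sup>2 * t) * log_moment u0 (\<lambda>s. cos (\<xi> * (s + b * t) + d))"
        unfolding b_def by (rule weak_solution_fourier_phase[OF u u0(1)]) (use \<open>t > 0\<close> in simp)
      also have "log_moment u0 (\<lambda>s. cos (\<xi> * (s + b * t) + d)) = (LINT z|lebesgue. w z * cos (\<xi> * (ln (norm z) + b * t) + d))"
        unfolding log_moment_def
      proof (rule Bochner_Integration.integral_cong_AE)
        show "(\<lambda>x. u0 x * cos (\<xi> * (ln (norm x) + b * t) + d) / (norm x)\<^sup>2) \<in> borel_measurable lebesgue"
          by (rule borel_measurable_integrable[OF in_L12_log_integrable[OF u0(1) m(2) abs_cos_le_one]])
        show "(\<lambda>z. w z * cos (\<xi> * (ln (norm z) + b * t) + d)) \<in> borel_measurable lebesgue"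
          by (rule measurable_completion) (use w(1) in simp)
        show "AE x in lebesgue. u0 x * cos (\<xi> * (ln (norm x) + b * t) + d) / (norm x)\<^sup>2 = w x * cos (\<xi> * (ln (norm x) + b * t) + d)"
          unfolding AE_completion_iff using w(3) by eventually_elim simp
      qed
      also have "\<dots> = (LINT z|lborel. w z * cos (\<xi> * (ln (norm z) + b * t) + d))"
        by (rule integral_completion) (use w(1) in simp)
      also have "exp (- \<xi>\<^sup>2 * t) * \<dots> = (LINT s|lborel. q s * cos (\<xi> * s + d))"
        unfolding q_def mix(2) using \<open>t > 0\<close> by (simp add: power_mult_distrib algebra_simps)
      finally show ?thesis .
    qed
  qed
  then have "AE x in lborel. p (ln (norm x)) = q (ln (norm (x::'a)))" by (rule AE_ln_norm)
  then have "AE x in lborel. u x t = exp (- b * ln (norm x)) * q (ln (norm x)) / \<omega>"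
    using uk
  proof eventually_elim
    case (elim x)
    show ?case unfolding elim(1)[symmetric] elim(2) p_def using \<omega> by (simp add: exp_minus field_simps)
  qed
  moreover have "exp (- b * S) * q S = (LINT z|lebesgue.
     exp (- (S - ln (norm z) + b * t)\<^sup>2 / (4 * t)) / sqrt (4 * pi * t) * (u0 z / norm z ^ DIM('a)))" for S
  proof -
    let ?H = "\<lambda>y. exp (- (y + b * t)\<^sup>2 / (4 * t)) / sqrt (4 * pi * t)"
    have "exp (- b * S) * q S = (LINT z|lborel. exp (- b * S) * normal_density (b * t) (sqrt (2 * t)) (S - ln (norm z)) * w z)"
      unfolding q_def by (simp only: integral_mult_right_zero mult.assoc)
    also have "\<dots> = (LINT z|lborel. ?H (S - ln (norm z)) * (exp (- b * ln (norm z)) * w z))"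
      unfolding gaussian_tilt[OF \<open>t > 0\<close>] by (simp add: mult_ac)
    also have "\<dots> = (LINT z|lebesgue. ?H (S - ln (norm z)) * (exp (- b * ln (norm z)) * w z))"
      by (rule integral_completion[symmetric]) (use w(1) in measurable)
    also have "\<dots> = (LINT z|lebesgue. ?H (S - ln (norm z)) * (u0 z / norm z ^ DIM('a)))"
    proof (rule Bochner_Integration.integral_cong_AE)
      show "(\<lambda>z. ?H (S - ln (norm z)) * (exp (- b * ln (norm z)) * w z)) \<in> borel_measurable lebesgue"
        by (rule measurable_completion) (use w(1) in measurable)
      have [measurable]: "u0 \<in> borel_measurable lebesgue" using u0(1) by (simp add: in_L12_def)
      have [measurable]: "(\<lambda>z::'a. ?H (S - ln (norm z))) \<in> borel_measurable lebesgue" "(\<lambda>z::'a. norm z ^ DIM('a)) \<in> borel_measurable lebesgue"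
        by (rule measurable_completion, measurable)+
      show "(\<lambda>z. ?H (S - ln (norm z)) * (u0 z / norm z ^ DIM('a))) \<in> borel_measurable lebesgue"
        by measurable
      show "AE z in lebesgue. ?H (S - ln (norm z)) * (exp (- b * ln (norm z)) * w z) = ?H (S - ln (norm z)) * (u0 z / norm z ^ DIM('a))"
        unfolding AE_completion_iff using w(3) AE_lborel_singleton[of "0::'a"]
      proof eventually_elim
        case (elim z)
        then have z: "norm z > 0" by simp
        have "b = real (DIM('a) - 2)" using dim by (simp add: b_def)
        then have "exp (b * ln (norm z)) = norm z ^ (DIM('a) - 2)"
          using z by (simp add: exp_of_nat_mult)
        then have e: "exp (- b * ln (norm z)) = 1 / norm z ^ (DIM('a) - 2)"
          by (simp add: exp_minus divide_inverse)
        have n: "norm z ^ DIM('a) = norm z ^ (DIM('a) - 2) * (norm z)\<^sup>2"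
          by (metis dim le_add_diff_inverse2 power_add)
        have "exp (- b * ln (norm z)) * w z = u0 z / norm z ^ DIM('a)"
          unfolding e n elim(1) by (simp only: times_divide_times_eq mult_1_left)
        then show ?case by (simp only:)
      qed
    qed
    finally show ?thesis .
  qed
  ultimately show ?thesis
    unfolding AE_completion_iff b_def[symmetric] \<omega>_def[symmetric] by simp
qed


section \<open>Convergence to the profile\<close>

text \<open>
  The Lipschitz constant 1 comes from \<open>2 * |x| \<le> 1 + x\<^sup>2 \<le> exp (x\<^sup>2)\<close>.
\<close>

lemma gauss_lipschitz: "\<bar>exp (- p\<^sup>2) - exp (- q\<^sup>2)\<bar> \<le> min 1 \<bar>p - q\<bar>" for p q :: real
proof -
  have "\<bar>exp (- p\<^sup>2) - exp (- q\<^sup>2)\<bar> \<le> 1"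
    using exp_gt_zero[of "- p\<^sup>2"] exp_gt_zero[of "- q\<^sup>2"] exp_le_one_iff[of "- p\<^sup>2"] exp_le_one_iff[of "- q\<^sup>2"]
    unfolding abs_le_iff by (smt (verit) zero_le_power2)
  moreover have "norm (exp (- p\<^sup>2) - exp (- q\<^sup>2)) \<le> 1 * norm (p - q)"
  proof (rule field_differentiable_bound[where S = UNIV])
    show "((\<lambda>x. exp (- x\<^sup>2)) has_field_derivative - (2 * x * exp (- x\<^sup>2))) (at x within UNIV)" for x :: real
      by (auto intro!: derivative_eq_intros)
    show "norm (- (2 * x * exp (- x\<^sup>2))) \<le> 1" for x :: real
    proof -
      have "2 * \<bar>x\<bar> \<le> 1 + x\<^sup>2" using zero_le_power2[of "\<bar>x\<bar> - 1"] by (simp add: power2_diff)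
      also have "\<dots> \<le> exp (x\<^sup>2)" by (rule exp_ge_add_one_self)
      finally show ?thesis by (simp add: abs_mult exp_minus field_simps)
    qed
  qed auto
  ultimately show ?thesis by simp
qed

lemma Linfty_norm_leI:
  assumes "f \<in> borel_measurable M" "AE x in M. \<bar>f x\<bar> \<le> c"
  shows "Linfty_norm M f \<le> ereal c"
  unfolding Linfty_norm_def by (rule esssup_I) (use assms in auto)

lemma Linfty_norm_nonneg:
  assumes "emeasure M (space M) \<noteq> 0"
  shows "0 \<le> Linfty_norm M f"
proof -
  have "AE x in M. ereal \<bar>f x\<bar> \<le> Linfty_norm M f"
    unfolding Linfty_norm_def by (rule esssup_AE)
  moreover have "ae_filter M \<noteq> bot" using assms by (simp add: ae_filter_eq_bot_iff)
  ultimately obtain x where "ereal \<bar>f x\<bar> \<le> Linfty_norm M f"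
    using eventually_happens' by blast
  then show ?thesis by (rule order_trans[rotated]) simp
qed

theorem theorem1p1:
  fixes u :: "'a::euclidean_space \<Rightarrow> real \<Rightarrow> real" and u0 :: "'a \<Rightarrow> real" and M :: real
  assumes "DIM('a) \<ge> 3"
    and "in_L12 u0"
    and "AE x in lebesgue. u0 x \<ge> 0"
    and "strong_solution u0 u"
    and "radially_symmetric u"
    and "integrable lebesgue (\<lambda>x. u0 x / norm x ^ DIM('a))"
    and "M = (LINT x|lebesgue. u0 x / norm x ^ DIM('a))"
    and "u0 0 = 0"
  shows "((\<lambda>t. ereal (t powr (1/2)) *
            Linfty_norm lebesgue (\<lambda>x. u x t - M / unit_sphere_area TYPE('a) * F x t))
          \<longlongrightarrow> 0) at_top"
proof -
  define b where "b = real DIM('a) - 2"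
  define \<omega> where "\<omega> = unit_sphere_area TYPE('a)"
  have \<omega>: "\<omega> > 0" unfolding \<omega>_def by (rule unit_sphere_area_pos)
  define v where "v z = u0 z / norm z ^ DIM('a)" for z
  have v: "integrable lebesgue v" "M = (LINT z|lebesgue. v z)"
    using assms(6,7) by (simp_all add: v_def[abs_def])
  have weak: "weak_solution u0 u" using assms(4) by (simp add: strong_solution_def)
  \<comment> \<open>the profile as a function of \<open>ln |x|\<close>\<close>
  define H where "H t y = exp (- (y + b * t)\<^sup>2 / (4 * t)) / sqrt (4 * pi * t)" for t y
  \<comment> \<open>the bound for \<open>sqrt t\<close> times the error, obtained by moving all the mass to \<open>ln |z| = 0\<close>\<close>
  define \<epsilon> where "\<epsilon> t = (LINT z|lebesgue. min 1 (\<bar>ln (norm z)\<bar> / (2 * sqrt t)) * \<bar>v z\<bar>) / \<omega>" for t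
  have [measurable]: "v \<in> borel_measurable lebesgue" using v(1) by auto
  have min_m: "(\<lambda>z::'a. min 1 (\<bar>ln (norm z)\<bar> / (2 * sqrt t))) \<in> borel_measurable lebesgue" for t
    by (rule borel_measurable_ln_norm[of "\<lambda>s. min 1 (\<bar>s\<bar> / (2 * sqrt t))"]) measurable
  have \<epsilon>: "(\<epsilon> \<longlongrightarrow> 0) at_top"
  proof -
    have "((\<lambda>t. LINT z|lebesgue. min 1 (\<bar>ln (norm z)\<bar> / (2 * sqrt t)) * \<bar>v z\<bar>) \<longlongrightarrow> (LINT z|(lebesgue :: 'a measure). 0)) at_top"
    proof (rule integral_dominated_convergence_at_top[where w = "\<lambda>z. \<bar>v z\<bar>"])
      show "\<forall>\<^sub>F t in at_top. AE z in lebesgue. norm (min 1 (\<bar>ln (norm z)\<bar> / (2 * sqrt t)) * \<bar>v z\<bar>) \<le> \<bar>v z\<bar>"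
        using eventually_gt_at_top[of 0]
      proof eventually_elim
        case (elim t)
        then show ?case by (intro AE_I2) (auto simp: abs_mult intro!: mult_left_le_one_le)
      qed
      have "((\<lambda>t. c / (2 * sqrt t)) \<longlongrightarrow> 0) at_top" for c :: real by real_asymp
      then have "((\<lambda>t. min 1 (c / (2 * sqrt t)) * d) \<longlongrightarrow> min 1 0 * d) at_top" for c d :: real
        by (intro tendsto_intros)
      then show "AE z in lebesgue. ((\<lambda>t. min 1 (\<bar>ln (norm z)\<bar> / (2 * sqrt t)) * \<bar>v z\<bar>) \<longlongrightarrow> 0) at_top"
        by simp
      show "(\<lambda>z. min 1 (\<bar>ln (norm z)\<bar> / (2 * sqrt t)) * \<bar>v z\<bar>) \<in> borel_measurable lebesgue" for t
        by (intro borel_measurable_times min_m borel_measurable_abs) simp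
    qed (use v(1) in simp_all)
    then have "((\<lambda>t. (LINT z|lebesgue. min 1 (\<bar>ln (norm z)\<bar> / (2 * sqrt t)) * \<bar>v z\<bar>) / \<omega>) \<longlongrightarrow> 0 / \<omega>) at_top"
      using \<omega> by (intro tendsto_intros) auto
    then show ?thesis by (simp add: \<epsilon>_def[abs_def])
  qed
  have kernel: "sqrt t * \<bar>H t (S - Z) - H t S\<bar> \<le> min 1 (\<bar>Z\<bar> / (2 * sqrt t))" if "t > 0" for t S Z
  proof -
    have H: "H t y = exp (- ((y + b * t) / (2 * sqrt t))\<^sup>2) / (2 * sqrt pi * sqrt t)" for y
      using that by (simp add: H_def power_divide power_mult_distrib real_sqrt_mult)
    have "sqrt pi \<ge> 1" using pi_gt3 by simp
    have "sqrt t * \<bar>H t (S - Z) - H t S\<bar> =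
        \<bar>exp (- ((S - Z + b * t) / (2 * sqrt t))\<^sup>2) - exp (- ((S + b * t) / (2 * sqrt t))\<^sup>2)\<bar> / (2 * sqrt pi)"
      unfolding H using that by (simp add: diff_divide_distrib[symmetric] abs_divide)
    also have "\<dots> \<le> \<bar>exp (- ((S - Z + b * t) / (2 * sqrt t))\<^sup>2) - exp (- ((S + b * t) / (2 * sqrt t))\<^sup>2)\<bar> / 1"
    proof (rule divide_left_mono)
      show "1 \<le> 2 * sqrt pi" using \<open>sqrt pi \<ge> 1\<close> by linarith
    qed auto
    also have "\<dots> \<le> min 1 \<bar>(S - Z + b * t) / (2 * sqrt t) - (S + b * t) / (2 * sqrt t)\<bar>"
      using gauss_lipschitz by simp
    also have "\<bar>(S - Z + b * t) / (2 * sqrt t) - (S + b * t) / (2 * sqrt t)\<bar> = \<bar>Z\<bar> / (2 * sqrt t)"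
      using that by (simp add: diff_divide_distrib[symmetric] abs_divide)
    finally show ?thesis .
  qed
  have bound: "Linfty_norm lebesgue (\<lambda>x. u x t - M / unit_sphere_area TYPE('a) * F x t) \<le> ereal (\<epsilon> t / sqrt t)" if t: "t > 0" for t
  proof (rule Linfty_norm_leI)
    have "(\<lambda>x. u x t) \<in> borel_measurable lebesgue"
      using weak t by (auto simp: weak_solution_def continuous_in_L12_def in_L12_def)
    moreover have "(\<lambda>x::'a. F x t) \<in> borel_measurable lebesgue"
      unfolding F_def Defs.G_def by (rule measurable_completion) measurable
    ultimately show "(\<lambda>x. u x t - M / unit_sphere_area TYPE('a) * F x t) \<in> borel_measurable lebesgue"
      by measurable
    have H_le: "\<bar>H t y\<bar> \<le> 1 / sqrt (4 * pi * t)" for y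
      using t by (simp add: H_def divide_right_mono)
    have Hm: "(\<lambda>y. H t y) \<in> borel_measurable borel" unfolding H_def by measurable
    have int1: "integrable lebesgue (\<lambda>z. v z * H t (S - ln (norm z)))" for S
      by (rule integrable_mult_bounded[OF v(1) _ H_le]) (rule borel_measurable_ln_norm[of "\<lambda>s. H t (S - s)"], use measurable_compose[OF _ Hm, of "\<lambda>s. S - s" borel] in simp)
    have AEx: "AE x in lebesgue. x \<noteq> (0::'a)"
      unfolding AE_completion_iff by (rule AE_lborel_singleton)
    have "DIM('a) \<ge> 2" using assms(1) by simp
    from radial_weak_solution_formula[OF this weak assms(2,3,5) t] AEx
    show "AE x in lebesgue. \<bar>u x t - M / unit_sphere_area TYPE('a) * F x t\<bar> \<le> \<epsilon> t / sqrt t"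
    proof eventually_elim
      case (elim x)
      define S where "S = ln (norm x)"
      have "F x t = H t S"
        using elim(2) t by (simp add: F_def Defs.G_def H_def S_def b_def power_divide power_mult_distrib)
      moreover have "u x t = (LINT z|lebesgue. v z * H t (S - ln (norm z))) / \<omega>"
        using elim(1) by (simp add: S_def H_def v_def b_def \<omega>_def mult.commute)
      moreover have "M * H t S = (LINT z|lebesgue. v z * H t S)"
        using v by simp
      ultimately have "u x t - M / unit_sphere_area TYPE('a) * F x t =
          ((LINT z|lebesgue. v z * H t (S - ln (norm z))) - (LINT z|lebesgue. v z * H t S)) / \<omega>"
        by (simp add: \<omega>_def diff_divide_distrib)
      also have "\<dots> = (LINT z|lebesgue. v z * (H t (S - ln (norm z)) - H t S)) / \<omega>"
        using Bochner_Integration.integral_diff[OF int1[of S] integrable_mult_left[of "H t S" lebesgue v]] v(1)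
        by (simp add: right_diff_distrib)
      finally have "\<bar>u x t - M / unit_sphere_area TYPE('a) * F x t\<bar> =
          \<bar>LINT z|lebesgue. v z * (H t (S - ln (norm z)) - H t S)\<bar> / \<omega>"
        using \<omega> by simp
      also have "\<dots> \<le> (LINT z|lebesgue. (min 1 (\<bar>ln (norm z)\<bar> / (2 * sqrt t)) * \<bar>v z\<bar>) / sqrt t) / \<omega>"
      proof (rule divide_right_mono)
        have "\<bar>LINT z|lebesgue. v z * (H t (S - ln (norm z)) - H t S)\<bar> \<le> (LINT z|lebesgue. \<bar>v z * (H t (S - ln (norm z)) - H t S)\<bar>)"
          by (rule integral_abs_bound)
        also have "\<dots> \<le> (LINT z|lebesgue. (min 1 (\<bar>ln (norm z)\<bar> / (2 * sqrt t)) * \<bar>v z\<bar>) / sqrt t)"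
        proof (rule integral_mono)
          show "integrable lebesgue (\<lambda>z. \<bar>v z * (H t (S - ln (norm z)) - H t S)\<bar>)"
            using int1[of S] integrable_mult_left[of "H t S" lebesgue v] v(1)
            by (simp add: right_diff_distrib)
          have "integrable lebesgue (\<lambda>z. \<bar>v z\<bar> * min 1 (\<bar>ln (norm z)\<bar> / (2 * sqrt t)))"
            by (rule integrable_mult_bounded[where K = 1]) (use v(1) t min_m in auto)
          then show "integrable lebesgue (\<lambda>z. (min 1 (\<bar>ln (norm z)\<bar> / (2 * sqrt t)) * \<bar>v z\<bar>) / sqrt t)"
            by (simp add: mult.commute)
          show "\<bar>v z * (H t (S - ln (norm z)) - H t S)\<bar> \<le> (min 1 (\<bar>ln (norm z)\<bar> / (2 * sqrt t)) * \<bar>v z\<bar>) / sqrt t" for z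
            unfolding abs_mult
            using mult_right_mono[OF kernel[OF t, of S "ln (norm z)"], of "\<bar>v z\<bar>"] t
            by (simp add: pos_le_divide_eq mult_ac)
        qed
        finally show "\<bar>LINT z|lebesgue. v z * (H t (S - ln (norm z)) - H t S)\<bar> \<le> (LINT z|lebesgue. (min 1 (\<bar>ln (norm z)\<bar> / (2 * sqrt t)) * \<bar>v z\<bar>) / sqrt t)" .
      qed (use \<omega> in simp)
      also have "\<dots> = \<epsilon> t / sqrt t" by (simp add: \<epsilon>_def)
      finally show ?case .
    qed
  qed
  show ?thesis
  proof (rule tendsto_sandwich)
    show "\<forall>\<^sub>F t in at_top. 0 \<le> ereal (t powr (1/2)) * Linfty_norm lebesgue (\<lambda>x. u x t - M / unit_sphere_area TYPE('a) * F x t)"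
      by (intro always_eventually allI ereal_0_le_mult Linfty_norm_nonneg) (auto simp: emeasure_lborel_UNIV)
    show "\<forall>\<^sub>F t in at_top. ereal (t powr (1/2)) * Linfty_norm lebesgue (\<lambda>x. u x t - M / unit_sphere_area TYPE('a) * F x t) \<le> ereal (\<epsilon> t)"
      using eventually_gt_at_top[of 0]
    proof eventually_elim
      case (elim t)
      have "ereal (t powr (1/2)) * Linfty_norm lebesgue (\<lambda>x. u x t - M / unit_sphere_area TYPE('a) * F x t) \<le>
          ereal (t powr (1/2)) * ereal (\<epsilon> t / sqrt t)"
        by (intro ereal_mult_left_mono bound elim) simp
      also have "\<dots> = ereal (\<epsilon> t)" using elim by (simp add: powr_half_sqrt)
      finally show ?case .
    qed
    show "((\<lambda>t. ereal (\<epsilon> t)) \<longlongrightarrow> 0) at_top"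
      using tendsto_ereal[OF \<epsilon>] by (simp add: zero_ereal_def)
  qed simp
qed

end
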